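(* Let $\Phi$ be the unstructured model, i.e. the set of all MDPs $\psi$ on $\mathcal{S},\mathcal{A}$ with $p_\psi(\cdot|x,a)\in\mathcal{P}(\mathcal{S})$ and $q_\psi(\cdot|x,a)\in\mathcal{P}([0,1])$ for all $(x,a)$, and let $\phi\in\Phi$ be ergodic. Then $$\mathcal{F}_\Phi(\phi)=\Big\{\eta\in\bar{\mathbb{R}}_+^{S\times A}:\ \forall (x,a)\text{ with }a\notin\mathcal{O}(x;\phi),\ \ \eta(x,a)\,\mathrm{KL}_{\phi\mid\psi}(x,a)\ge 1\ \ \forall\psi\in\Delta_\Phi(x,a;\phi)\Big\},$$ where $$\Delta_\Phi(x,a;\phi)=\Big\{\psi\in\Phi:\ \phi\ll\psi,\ \mathrm{KL}_{\phi\mid\psi}(y,b)=0\ \ \forall (y,b)\ne(x,a),\ \text{ and }\ (\mathbf{B}_\psi^a h_\phi^* )(x)>g_\phi^*+h_\phi^*(x)\Big\}.$$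
   Context: MDPs. $\mathcal{S}$ and $\mathcal{A}$ are finite sets of sizes $S$ and $A$. An MDP $\phi=(p_\phi,q_\phi)$ consists of transition probabilities $p_\phi(y|x,a)$ and reward distributions $q_\phi(\cdot|x,a)$ on $[0,1]$, with mean $r_\phi(x,a)$, each absolutely continuous w.r.t. a fixed measure $\lambda$ on $[0,1]$ (density also denoted $q_\phi$). $\mathcal{P}(\mathcal{S})$ is the set of distributions on $\mathcal{S}$, and $\mathcal{P}([0,1])$ the set of distributions on $[0,1]$ absolutely continuous w.r.t. $\lambda$. $X_t,A_t,R_t$ denote the state, action and reward at step $t$. Gain, bias. $\Pi_D$ is the set of stationary deterministic policies $f:\mathcal{S}\to\mathcal{A}$. $\phi$ is ergodic if under every $f\in\Pi_D$ the Markov chain $(X_t)$ is irreducible. The gain is $g_\phi^f(x)=\lim_{T\to\infty}\frac1T \mathbb{E}_x^f[\sum_{t=1}^T R_t]$, $g_\phi^*$ is the maximal gain (over all policies; a constant for ergodic $\phi$), and $\Pi^*(\phi)$ is the set of $f\in\Pi_D$ whose gain is maximal from every state. The bias of $f$ is $h_\phi^f(x)=\text{C-}\lim_{T\to\infty}\mathbb{E}_x^f[\sum_{t=1}^{T}(R_t-g_\phi^f(X_t))]$ (Cesàro limit), and $h_\phi^*$ is the bias function of an optimal stationary policy (unique up to an additive constant for ergodic $\phi$). For $h:\mathcal{S}\to\mathbb{R}$, $(\mathbf{B}_\phi^a h)(x)=r_\phi(x,a)+\sum_y p_\phi(y|x,a)h(y)$ and $(\mathbf{B}_\phi^* h)(x)=\max_{a\in\mathcal{A}}(\mathbf{B}_\phi^a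 h)(x)$. $\mathcal{O}(x;\phi)=\{a:(\mathbf{B}_\phi^* h_\phi^* )(x)=(\mathbf{B}_\phi^a h_\phi^* )(x)\}$. Confusing MDPs. $\phi\ll\psi$ means that the kernels of $\phi$ are absolutely continuous w.r.t. those of $\psi$. For $\phi\ll\psi$, $$\mathrm{KL}_{\phi\mid\psi}(x,a)=\sum_{y}p_\phi(y|x,a)\log\frac{p_\phi(y|x,a)}{p_\psi(y|x,a)}+\int_0^1 q_\phi(r|x,a)\log\frac{q_\phi(r|x,a)}{q_\psi(r|x,a)}\lambda(dr).$$ $\Delta_\Phi(\phi)$ is the set of $\psi\in\Phi$ with $\phi\ll\psi$ such that (i) $\mathrm{KL}_{\phi\mid\psi}(x,a)=0$ for all $x$ and all $a\in\mathcal{O}(x;\phi)$, and (ii) $\Pi^*(\phi)\cap\Pi^*(\psi)=\emptyset$. Then $$\mathcal{F}_\Phi(\phi)=\Big\{\eta\in\bar{\mathbb{R}}_+^{S\times A}:\ \sum_{(x,a)}\eta(x,a)\,\mathrm{KL}_{\phi\mid\psi}(x,a)\ge 1\ \ \forall\psi\in\Delta_\Phi(\phi)\Big\},$$ where $\bar{\mathbb{R}}_+=\mathbb{R}_+\cup\{\infty\}$, with $\infty\cdot 0=0$. *)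

theory Defs
  imports "HOL-Probability.Probability"
begin

section \<open>Markov decision processes\<close>

text \<open>States and actions are finite types. A transition law is an element of
  \<open>\<P>(\<S>)\<close>, rendered as a pmf; a reward law is a measure on the Borel sets of \<open>[0,1]\<close>.\<close>

record ('s, 'a) mdp =
  trans :: "'s \<Rightarrow> 'a \<Rightarrow> 's pmf"
  rew :: "'s \<Rightarrow> 'a \<Rightarrow> real measure"

definition unit_borel :: "real measure" where
  "unit_borel = restrict_space borel {0..1}"

text \<open>The elements of \<open>\<P>([0,1])\<close> are the probability measures that possess a density with
  respect to \<open>lam\<close>. For \<open>\<sigma>\<close>-finite \<open>lam\<close> this is absolute continuity (Radon--Nikodym, see
  \<open>reward_laws_iff_absolutely_continuous\<close> below); for other \<open>lam\<close> the existence of the density,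
  which the definition of the divergence uses, has to be required.\<close>

definition reward_laws :: "real measure \<Rightarrow> real measure set" where
  "reward_laws lam = {Q. prob_space Q \<and> (\<exists>f\<in>borel_measurable lam. Q = density lam f)}"

definition unstructured :: "real measure \<Rightarrow> ('s::finite, 'a::finite) mdp set" where
  "unstructured lam = {\<psi>. \<forall>x a. rew \<psi> x a \<in> reward_laws lam}"

definition mean_rew :: "('s, 'a) mdp \<Rightarrow> 's \<Rightarrow> 'a \<Rightarrow> real" where
  "mean_rew \<phi> x a = (\<integral>r. r \<partial>rew \<phi> x a)"

section \<open>Policies and the induced process\<close>

text \<open>One step of the process is a triple (state, action, reward). Steps are numbered from 0, so
  coordinate \<open>t\<close> of a trajectory holds the triple of step \<open>t + 1\<close> of the usual numbering.\<close>

definition step_space :: "('s \<times> 'a \<times> real) measure" where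
  "step_space = count_space UNIV \<Otimes>\<^sub>M count_space UNIV \<Otimes>\<^sub>M unit_borel"

definition state_at :: "nat \<Rightarrow> (nat \<Rightarrow> 's \<times> 'a \<times> real) \<Rightarrow> 's" where
  "state_at t \<omega> = fst (\<omega> t)"

definition action_at :: "nat \<Rightarrow> (nat \<Rightarrow> 's \<times> 'a \<times> real) \<Rightarrow> 'a" where
  "action_at t \<omega> = fst (snd (\<omega> t))"

definition reward_at :: "nat \<Rightarrow> (nat \<Rightarrow> 's \<times> 'a \<times> real) \<Rightarrow> real" where
  "reward_at t \<omega> = snd (snd (\<omega> t))"

text \<open>A policy may randomise and may depend, measurably, on the whole past: \<open>\<pi> t \<omega> y\<close> is the law of
  the action at time \<open>t\<close> given the current state \<open>y\<close> and the completed steps \<open>\<omega>\<close>, a function on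
  \<open>{0..<t}\<close>.\<close>

type_synonym ('s, 'a) policy = "nat \<Rightarrow> (nat \<Rightarrow> 's \<times> 'a \<times> real) \<Rightarrow> 's \<Rightarrow> 'a pmf"

definition policies :: "('s::finite, 'a::finite) policy set" where
  "policies = {\<pi>. \<forall>t y a.
     (\<lambda>\<omega>. pmf (\<pi> t \<omega> y) a) \<in> borel_measurable (PiM {0..<t} (\<lambda>_. step_space))}"

definition stationary :: "('s \<Rightarrow> 'a) \<Rightarrow> ('s, 'a) policy" where
  "stationary f = (\<lambda>t \<omega> y. return_pmf (f y))"

definition next_state :: "('s, 'a) mdp \<Rightarrow> 's \<Rightarrow> nat \<Rightarrow> (nat \<Rightarrow> 's \<times> 'a \<times> real) \<Rightarrow> 's pmf" where
  "next_state \<phi> x t \<omega> =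
     (case t of 0 \<Rightarrow> return_pmf x | Suc k \<Rightarrow> trans \<phi> (state_at k \<omega>) (action_at k \<omega>))"

definition step_kernel ::
  "('s, 'a) mdp \<Rightarrow> ('s, 'a) policy \<Rightarrow> 's \<Rightarrow> nat \<Rightarrow> (nat \<Rightarrow> 's \<times> 'a \<times> real)
     \<Rightarrow> ('s \<times> 'a \<times> real) measure" where
  "step_kernel \<phi> \<pi> x t \<omega> =
     measure_pmf (bind_pmf (next_state \<phi> x t \<omega>) (\<lambda>y. map_pmf (Pair y) (\<pi> t \<omega> y)))
       \<bind> (\<lambda>(y, a). distr (rew \<phi> y a) step_space (\<lambda>r. (y, a, r)))"

text \<open>The law of the whole trajectory under \<open>\<pi>\<close> from the initial state \<open>x\<close>: the Ionescu-Tulcea limit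
  of the step kernels (see \<open>Ionescu_Tulcea_step_kernel\<close> below).\<close>

definition process ::
  "('s, 'a) mdp \<Rightarrow> ('s, 'a) policy \<Rightarrow> 's \<Rightarrow> (nat \<Rightarrow> 's \<times> 'a \<times> real) measure" where
  "process \<phi> \<pi> x =
     projective_family.lim UNIV (Ionescu_Tulcea.CI (step_kernel \<phi> \<pi> x) (\<lambda>_. step_space))
       (\<lambda>_. step_space)"

definition ergodic :: "('s::finite, 'a::finite) mdp \<Rightarrow> bool" where
  "ergodic \<phi> \<longleftrightarrow>
     (\<forall>f x y. \<exists>t. measure (process \<phi> (stationary f) x)
        {\<omega> \<in> space (process \<phi> (stationary f) x). state_at t \<omega> = y} > 0)"

section \<open>Gain and bias\<close>

definition avg_rew :: "('s, 'a) mdp \<Rightarrow> ('s, 'a) policy \<Rightarrow> 's \<Rightarrow> nat \<Rightarrow> real" where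
  "avg_rew \<phi> \<pi> x T = (\<integral>\<omega>. (\<Sum>t<T. reward_at t \<omega>) \<partial>process \<phi> \<pi> x) / real T"

definition gain :: "('s, 'a) mdp \<Rightarrow> ('s \<Rightarrow> 'a) \<Rightarrow> 's \<Rightarrow> real" where
  "gain \<phi> f x = lim (avg_rew \<phi> (stationary f) x)"

text \<open>For a general policy the averages need not converge, and its gain is their lower limit.\<close>

definition opt_gain :: "('s::finite, 'a::finite) mdp \<Rightarrow> 's \<Rightarrow> real" where
  "opt_gain \<phi> x =
     real_of_ereal (SUP \<pi>\<in>policies. liminf (\<lambda>T. ereal (avg_rew \<phi> \<pi> x T)))"

definition opt_policies :: "('s::finite, 'a::finite) mdp \<Rightarrow> ('s \<Rightarrow> 'a) set" where
  "opt_policies \<phi> = {f. \<forall>x. gain \<phi> f x = opt_gain \<phi> x}"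

definition cesaro_lim :: "(nat \<Rightarrow> real) \<Rightarrow> real" where
  "cesaro_lim s = lim (\<lambda>N. (\<Sum>T=1..N. s T) / real N)"

definition bias :: "('s, 'a) mdp \<Rightarrow> ('s \<Rightarrow> 'a) \<Rightarrow> 's \<Rightarrow> real" where
  "bias \<phi> f x = cesaro_lim (\<lambda>T.
     \<integral>\<omega>. (\<Sum>t<T. reward_at t \<omega> - gain \<phi> f (state_at t \<omega>)) \<partial>process \<phi> (stationary f) x)"

text \<open>The choice of the optimal policy affects the bias function of an ergodic MDP only by an additive
  constant, which cancels wherever \<open>opt_bias\<close> is used.\<close>

definition opt_bias :: "('s::finite, 'a::finite) mdp \<Rightarrow> 's \<Rightarrow> real" where
  "opt_bias \<phi> = bias \<phi> (SOME f. f \<in> opt_policies \<phi>)"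

definition bellman :: "('s::finite, 'a) mdp \<Rightarrow> 'a \<Rightarrow> ('s \<Rightarrow> real) \<Rightarrow> 's \<Rightarrow> real" where
  "bellman \<phi> a h x = mean_rew \<phi> x a + (\<Sum>y\<in>UNIV. pmf (trans \<phi> x a) y * h y)"

definition bellman_opt :: "('s::finite, 'a::finite) mdp \<Rightarrow> ('s \<Rightarrow> real) \<Rightarrow> 's \<Rightarrow> real" where
  "bellman_opt \<phi> h x = (MAX a. bellman \<phi> a h x)"

definition opt_actions :: "('s::finite, 'a::finite) mdp \<Rightarrow> 's \<Rightarrow> 'a set" where
  "opt_actions \<phi> x = {a. bellman_opt \<phi> (opt_bias \<phi>) x = bellman \<phi> a (opt_bias \<phi>) x}"

section \<open>Confusing MDPs\<close>

definition mdp_abs_cont :: "('s, 'a) mdp \<Rightarrow> ('s, 'a) mdp \<Rightarrow> bool" (infix "\<lless>" 50) where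
  "\<phi> \<lless> \<psi> \<longleftrightarrow> (\<forall>x a.
     absolutely_continuous (measure_pmf (trans \<psi> x a)) (measure_pmf (trans \<phi> x a)) \<and>
     absolutely_continuous (rew \<psi> x a) (rew \<phi> x a))"

text \<open>The reward part of the divergence may be infinite, where the Bochner integral would return 0.
  The negative part of its integrand always has integral at most 1.\<close>

definition ext_integral :: "'b measure \<Rightarrow> ('b \<Rightarrow> real) \<Rightarrow> ereal" where
  "ext_integral M f =
     enn2ereal (\<integral>\<^sup>+z. ennreal (f z) \<partial>M) - enn2ereal (\<integral>\<^sup>+z. ennreal (- f z) \<partial>M)"

definition rew_dens :: "real measure \<Rightarrow> ('s, 'a) mdp \<Rightarrow> 's \<Rightarrow> 'a \<Rightarrow> real \<Rightarrow> real" where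
  "rew_dens lam \<phi> x a r = enn2real (RN_deriv lam (rew \<phi> x a) r)"

definition KL ::
  "real measure \<Rightarrow> ('s::finite, 'a) mdp \<Rightarrow> ('s, 'a) mdp \<Rightarrow> 's \<Rightarrow> 'a \<Rightarrow> ereal" where
  "KL lam \<phi> \<psi> x a =
     ereal (\<Sum>y\<in>UNIV. pmf (trans \<phi> x a) y * ln (pmf (trans \<phi> x a) y / pmf (trans \<psi> x a) y))
     + ext_integral lam
         (\<lambda>r. rew_dens lam \<phi> x a r * ln (rew_dens lam \<phi> x a r / rew_dens lam \<psi> x a r))"

definition confusing ::
  "real measure \<Rightarrow> ('s::finite, 'a::finite) mdp set \<Rightarrow> ('s, 'a) mdp \<Rightarrow> ('s, 'a) mdp set" where
  "confusing lam \<Phi> \<phi> = {\<psi> \<in> \<Phi>. \<phi> \<lless> \<psi> \<and>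
     (\<forall>x. \<forall>a\<in>opt_actions \<phi> x. KL lam \<phi> \<psi> x a = 0) \<and>
     opt_policies \<phi> \<inter> opt_policies \<psi> = {}}"

definition confusing_at ::
  "real measure \<Rightarrow> ('s::finite, 'a::finite) mdp set \<Rightarrow> 's \<Rightarrow> 'a \<Rightarrow> ('s, 'a) mdp \<Rightarrow> ('s, 'a) mdp set" where
  "confusing_at lam \<Phi> x a \<phi> = {\<psi> \<in> \<Phi>. \<phi> \<lless> \<psi> \<and>
     (\<forall>y b. (y, b) \<noteq> (x, a) \<longrightarrow> KL lam \<phi> \<psi> y b = 0) \<and>
     bellman \<psi> a (opt_bias \<phi>) x > opt_gain \<phi> x + opt_bias \<phi> x}"

definition feasible ::
  "real measure \<Rightarrow> ('s::finite, 'a::finite) mdp set \<Rightarrow> ('s, 'a) mdp \<Rightarrow> ('s \<Rightarrow> 'a \<Rightarrow> ereal) set" where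
  "feasible lam \<Phi> \<phi> = {\<eta>. (\<forall>x a. 0 \<le> \<eta> x a) \<and>
     (\<forall>\<psi>\<in>confusing lam \<Phi> \<phi>. (\<Sum>(x, a)\<in>UNIV. \<eta> x a * KL lam \<phi> \<psi> x a) \<ge> 1)}"

section \<open>Well-definedness\<close>

lemma reward_laws_iff_absolutely_continuous:
  assumes "sigma_finite_measure lam"
  shows "Q \<in> reward_laws lam \<longleftrightarrow>
    prob_space Q \<and> sets Q = sets lam \<and> absolutely_continuous lam Q"
  using sigma_finite_measure.Radon_Nikodym[OF assms, of Q]
  by (auto simp: reward_laws_def absolutely_continuousI_density)

lemma stationary_in_policies: "stationary f \<in> policies"
  by (simp add: stationary_def policies_def)

lemma measurable_pmf_finite:
  fixes p :: "'w \<Rightarrow> 'b::finite pmf"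
  assumes "\<And>z. (\<lambda>\<omega>. pmf (p \<omega>) z) \<in> borel_measurable N"
  shows "(\<lambda>\<omega>. measure_pmf (p \<omega>)) \<in> measurable N (subprob_algebra (count_space UNIV))"
proof (rule measurable_subprob_algebra)
  fix A :: "'b set"
  have "(\<lambda>\<omega>. emeasure (measure_pmf (p \<omega>)) A) = (\<lambda>\<omega>. \<Sum>z\<in>A. ennreal (pmf (p \<omega>) z))"
    by (auto simp: emeasure_measure_pmf_finite)
  then show "(\<lambda>\<omega>. emeasure (measure_pmf (p \<omega>)) A) \<in> borel_measurable N"
    using assms by simp
qed (simp_all add: measure_pmf.subprob_space_axioms)

lemma Ionescu_Tulcea_step_kernel:
  fixes \<phi> :: "('s::finite, 'a::finite) mdp"
  assumes lam: "sets lam = sets unit_borel"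
    and \<phi>: "\<phi> \<in> unstructured lam" and \<pi>: "\<pi> \<in> policies"
  shows "Ionescu_Tulcea (step_kernel \<phi> \<pi> x) (\<lambda>_. step_space)"
proof (rule Ionescu_Tulcea.intro)
  fix t :: nat
  let ?N = "PiM {0..<t} (\<lambda>_. step_space :: ('s \<times> 'a \<times> real) measure)"
  let ?p = "\<lambda>\<omega>. bind_pmf (next_state \<phi> x t \<omega>) (\<lambda>y. map_pmf (Pair y) (\<pi> t \<omega> y))"
  let ?K = "\<lambda>(y, a). distr (rew \<phi> y a) step_space (\<lambda>r. (y, a, r))"
  have rew: "prob_space (rew \<phi> y a)" "sets (rew \<phi> y a) = sets unit_borel" for y a
  proof -
    have "rew \<phi> y a \<in> reward_laws lam"
      using \<phi> by (simp add: unstructured_def)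
    then show "prob_space (rew \<phi> y a)" "sets (rew \<phi> y a) = sets unit_borel"
      by (auto simp: reward_laws_def lam)
  qed
  have embed: "(\<lambda>r. (y, a, r)) \<in> measurable (rew \<phi> y a) step_space" for y a
    by (simp add: step_space_def measurable_cong_sets[OF rew(2) refl])
  have K_prob: "prob_space (?K z)" for z
    using rew(1) embed by (auto split: prod.split intro: prob_space.prob_space_distr)
  have K: "?K \<in> measurable (count_space UNIV) (subprob_algebra step_space)"
    using K_prob by (auto simp: space_subprob_algebra prob_space_imp_subprob_space split: prod.split)
  have nxt: "(\<lambda>\<omega>. pmf (next_state \<phi> x t \<omega>) y) \<in> borel_measurable ?N" for y
  proof (cases t)
    case (Suc k)
    have "(\<lambda>\<omega>. \<omega> k) \<in> measurable ?N step_space"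
      by (rule measurable_component_singleton) (simp add: Suc)
    then have 1: "(\<lambda>\<omega>. fst (\<omega> k)) \<in> measurable ?N (count_space UNIV)"
      and 2: "(\<lambda>\<omega>. fst (snd (\<omega> k))) \<in> measurable ?N (count_space UNIV)"
      unfolding step_space_def by measurable
    have "(\<lambda>\<omega>. (fst (\<omega> k), fst (snd (\<omega> k)))) \<in> measurable ?N (count_space UNIV \<Otimes>\<^sub>M count_space UNIV)"
      using 1 2 by (rule measurable_Pair)
    then have "(\<lambda>\<omega>. (fst (\<omega> k), fst (snd (\<omega> k)))) \<in> measurable ?N (count_space UNIV)"
      by (simp add: pair_measure_countable)
    from measurable_compose[OF this, of "\<lambda>(u, a). pmf (trans \<phi> u a) y" borel]
    show ?thesis
      by (simp add: next_state_def Suc state_at_def action_at_def)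
  qed (simp add: next_state_def)
  have pmf: "pmf (?p \<omega>) (y, a) = pmf (next_state \<phi> x t \<omega>) y * pmf (\<pi> t \<omega> y) a" for \<omega> y a
  proof -
    have eq: "pmf (map_pmf (Pair u) (\<pi> t \<omega> u)) (y, a) = (if u = y then pmf (\<pi> t \<omega> y) a else 0)" for u
      by (auto simp: pmf_map_inj' inj_on_def intro!: pmf_map_outside)
    show ?thesis
      by (simp add: pmf_bind integral_measure_pmf_real[of UNIV] eq if_distrib if_distribR mult.commute
          cong: if_cong)
  qed
  have "(\<lambda>\<omega>. measure_pmf (?p \<omega>)) \<in> measurable ?N (subprob_algebra (count_space UNIV))"
  proof (rule measurable_pmf_finite)
    fix z :: "'s \<times> 'a"
    show "(\<lambda>\<omega>. pmf (?p \<omega>) z) \<in> borel_measurable ?N"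
      using nxt \<pi> by (cases z) (auto simp: pmf policies_def intro!: borel_measurable_times)
  qed
  then show "step_kernel \<phi> \<pi> x t \<in> measurable ?N (subprob_algebra step_space)"
    unfolding step_kernel_def by (rule measurable_bind2) (rule K)
  show "prob_space (step_kernel \<phi> \<pi> x t \<omega>)" if "\<omega> \<in> space ?N" for \<omega>
    unfolding step_kernel_def
    using K_prob K by (intro measure_pmf.prob_space_bind[where S=step_space]) auto
qed

lemma prob_space_process:
  fixes \<phi> :: "('s::finite, 'a::finite) mdp"
  assumes "sets lam = sets unit_borel" "\<phi> \<in> unstructured lam" "\<pi> \<in> policies"
  shows "prob_space (process \<phi> \<pi> x)"
proof -
  interpret Ionescu_Tulcea "step_kernel \<phi> \<pi> x" "\<lambda>_. step_space"
    by (rule Ionescu_Tulcea_step_kernel[OF assms])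
  show ?thesis
    unfolding process_def
  proof (rule prob_space_distrD)
    show "(\<lambda>\<omega>. restrict \<omega> {}) \<in> measurable PF.lim (PiM {} (\<lambda>_. step_space))"
      by (simp add: measurable_cong_sets[OF PF.sets_lim refl])
    show "prob_space (distr PF.lim (PiM {} (\<lambda>_. step_space)) (\<lambda>\<omega>. restrict \<omega> {}))"
      by (simp only: distr_lim[OF finite.emptyI] PF.prob_space_P[OF finite.emptyI subset_UNIV])
  qed
qed

end

theory Submission
  imports Defs
begin

text \<open>Policy improvement shows that in an ergodic \<open>\<phi>\<close> the bias \<open>h\<^sup>*\<close> satisfies
  \<open>\<^bold>B\<^sup>a h\<^sup>* \<le> g\<^sup>* + h\<^sup>*\<close>, with equality at \<open>f x\<close> for all \<open>x\<close> and all optimal \<open>f\<close>. Absolute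
  continuity \<open>\<phi> \<lless> \<psi>\<close> makes every stationary policy irreducible in \<open>\<psi>\<close> as well. Hence if \<open>\<psi>\<close> agrees
  with \<open>\<phi>\<close> on the optimal actions, some non-optimal pair \<open>(x, a)\<close> with \<open>\<^bold>B\<^sub>\<psi>\<^sup>a h\<^sup>* x > g\<^sup>* + h\<^sup>* x\<close>
  makes the optimal policies of \<open>\<phi>\<close> non-optimal in \<open>\<psi>\<close> (switch to \<open>a\<close> in \<open>x\<close>), while without such
  a pair they stay optimal. Since \<open>\<Phi>\<close> is unstructured, a single pair of \<open>\<psi>\<close> can be transplanted into
  \<open>\<phi>\<close>, so the constraints for single pairs imply all others.\<close>

section \<open>Finite Markov chains\<close>

definition markov_op :: "('s::finite \<Rightarrow> 's pmf) \<Rightarrow> ('s \<Rightarrow> real) \<Rightarrow> 's \<Rightarrow> real" where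
  "markov_op P w x = (\<Sum>y\<in>UNIV. pmf (P x) y * w y)"

text \<open>Only positivity of transition probabilities enters, so the property passes to every
  kernel that charges at least the same transitions.\<close>

definition irreducible_chain :: "('s \<Rightarrow> 's pmf) \<Rightarrow> bool" where
  "irreducible_chain P \<longleftrightarrow> (\<forall>x y. (x, y) \<in> {(x, y). 0 < pmf (P x) y}\<^sup>*)"

section \<open>The transition operator: algebra, minimum principle, Poisson equation\<close>

lemma sum_pmf_finite_type [simp]: "(\<Sum>y\<in>UNIV. pmf p y) = (1::real)" for p :: "'s::finite pmf"
  by (rule sum_pmf_eq_1) auto

lemma markov_op_const [simp]: "markov_op P (\<lambda>_. c) = (\<lambda>_. c)"
  by (simp add: markov_op_def fun_eq_iff flip: sum_distrib_right)

lemma markov_op_diff: "markov_op P (\<lambda>y. v y - w y) x = markov_op P v x - markov_op P w x"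
  by (simp add: markov_op_def algebra_simps sum_subtractf)

lemma markov_op_add: "markov_op P (\<lambda>y. v y + w y) x = markov_op P v x + markov_op P w x"
  by (simp add: markov_op_def algebra_simps sum.distrib)

lemma markov_op_scale: "markov_op P (\<lambda>y. c * w y) x = c * markov_op P w x"
  by (simp add: markov_op_def sum_distrib_left mult_ac)

lemma markov_op_mono: "(\<And>y. v y \<le> w y) \<Longrightarrow> markov_op P v x \<le> markov_op P w x"
  unfolding markov_op_def by (intro sum_mono mult_left_mono) auto

lemma funpow_markov_op_const: "(markov_op P ^^ t) (\<lambda>_. c) = (\<lambda>_. c)"
  by (induction t) simp_all

lemma funpow_markov_op_diff:
  "(markov_op P ^^ t) (\<lambda>y. v y - w y) = (\<lambda>x. (markov_op P ^^ t) v x - (markov_op P ^^ t) w x)"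
proof (induction t)
  case (Suc t)
  then show ?case using markov_op_diff[of P] by fastforce
qed simp

lemma funpow_markov_op_add:
  "(markov_op P ^^ t) (\<lambda>y. v y + w y) = (\<lambda>x. (markov_op P ^^ t) v x + (markov_op P ^^ t) w x)"
proof (induction t)
  case (Suc t)
  then show ?case using markov_op_add[of P] by fastforce
qed simp

lemma funpow_markov_op_abs_le:
  assumes "\<And>y. \<bar>w y\<bar> \<le> B"
  shows "\<bar>(markov_op P ^^ t) w x\<bar> \<le> B"
proof -
  have "(markov_op P ^^ t) w x \<in> {-B..B}"
  proof (induction t arbitrary: x)
    case 0
    then show ?case using assms[of x] by auto
  next
    case (Suc t)
    have "markov_op P ((markov_op P ^^ t) w) x \<le> markov_op P (\<lambda>_. B) x"
      and "markov_op P (\<lambda>_. -B) x \<le> markov_op P ((markov_op P ^^ t) w) x"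
      by (intro markov_op_mono; use Suc in simp)+
    then show ?case by simp
  qed
  then show ?thesis by auto
qed

text \<open>Minimum principle: an average not exceeding the minimum forces all successors of a
  minimiser to be minimisers, and irreducibility spreads this to every state.\<close>

lemma superharmonic_const:
  fixes w :: "'s::finite \<Rightarrow> real"
  assumes irr: "irreducible_chain P" and sup: "\<And>x. markov_op P w x \<le> w x"
  shows "w x = w y"
proof -
  define m where "m = Min (range w)"
  have m_le: "m \<le> w z" for z unfolding m_def by simp
  have "m \<in> range w" unfolding m_def by (rule Min_in) auto
  then obtain z0 where z0: "w z0 = m" by auto
  have step: "w z' = m" if "w z = m" "0 < pmf (P z) z'" for z z'
  proof -
    \<comment> \<open>After subtracting the minimum all terms are nonnegative, so the term of
      \<open>z'\<close> alone is bounded by a nonpositive sum.\<close>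
    have "markov_op P (\<lambda>y. w y - m) z \<le> 0"
      using sup[of z] that(1) by (simp add: markov_op_diff)
    then have le: "(\<Sum>y\<in>UNIV. pmf (P z) y * (w y - m)) \<le> 0" by (simp add: markov_op_def)
    have "pmf (P z) z' * (w z' - m) \<le> (\<Sum>y\<in>UNIV. pmf (P z) y * (w y - m))"
      by (rule member_le_sum) (use m_le in auto)
    with le have "pmf (P z) z' * (w z' - m) \<le> 0" by linarith
    with that(2) m_le[of z'] show ?thesis by (simp add: mult_le_0_iff)
  qed
  have "w z = m" for z
  proof -
    have "(z0, z) \<in> {(x, y). 0 < pmf (P x) y}\<^sup>*" using irr by (auto simp: irreducible_chain_def)
    then show ?thesis by induction (use z0 step in auto)
  qed
  then show ?thesis by simp
qed

text \<open>If \<open>d \<le> 0\<close>, then \<open>w\<close> is superharmonic, hence constant, and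
  the drift at \<open>z\<close> would be just \<open>d\<close>. This replaces averaging against a
  stationary distribution.\<close>

lemma irreducible_drift_pos:
  fixes w :: "'s::finite \<Rightarrow> real"
  assumes irr: "irreducible_chain P" and nonneg: "\<And>x. 0 \<le> d + (w x - markov_op P w x)"
    and pos: "0 < d + (w z - markov_op P w z)"
  shows "0 < d"
proof (rule ccontr)
  assume "\<not> 0 < d"
  then have "markov_op P w x \<le> w x" for x using nonneg[of x] by linarith
  from superharmonic_const[OF irr this] have "w = (\<lambda>_. w z)" by (intro ext)
  then have "markov_op P w z = w z" by (metis markov_op_const)
  with pos \<open>\<not> 0 < d\<close> show False by simp
qed

text \<open>The map \<open>w \<mapsto> w x\<^sub>0 + (I - P) (w - w x\<^sub>0 e)\<close>, with \<open>e\<close> the indicator of \<open>x\<^sub>0\<close>, is an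
  injective endomorphism of a finite-dimensional space, hence onto.\<close>

lemma poisson_solution:
  fixes v :: "'s::finite \<Rightarrow> real"
  assumes irr: "irreducible_chain P"
  obtains c u where "\<And>x. v x = c + (u x - markov_op P u x)"
proof -
  define x0 :: 's where "x0 = undefined"
  define Z :: "real ^ 's \<Rightarrow> 's \<Rightarrow> real" where "Z w = (\<lambda>y. if y = x0 then 0 else w $ y)" for w
  define L :: "real ^ 's \<Rightarrow> real ^ 's" where
    "L w = (\<chi> x. w $ x0 + (Z w x - markov_op P (Z w) x))" for w
  have Z_add: "Z (v + w) = (\<lambda>y. Z v y + Z w y)" and Z_scale: "Z (r *\<^sub>R w) = (\<lambda>y. r * Z w y)" for v w r
    by (auto simp: Z_def fun_eq_iff)
  have lin: "linear L"
    by (rule linearI) (simp_all add: L_def vec_eq_iff Z_add Z_scale markov_op_add markov_op_scale algebra_simps)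
  have inj: "inj L"
  proof (subst linear_injective_0[OF lin], intro allI impI)
    fix w assume "L w = 0"
    then have eq: "w $ x0 + (Z w x - markov_op P (Z w) x) = 0" for x
      by (simp add: L_def vec_eq_iff)
    \<comment> \<open>The sign of \<open>w $ x0\<close> decides whether \<open>Z w\<close> or
      \<open>- Z w\<close> is superharmonic. A negative value makes \<open>Z w\<close> constant and
      contradicts \<open>eq\<close>; otherwise \<open>- Z w\<close> is constant, and it vanishes at
      \<open>x0\<close>.\<close>
    have "\<not> w $ x0 < 0"
    proof
      assume "w $ x0 < 0"
      then have "markov_op P (Z w) x \<le> Z w x" for x using eq[of x] by linarith
      from superharmonic_const[OF irr this] have "Z w = (\<lambda>_. Z w x0)" by (intro ext)
      then have "markov_op P (Z w) x0 = Z w x0" by (metis markov_op_const)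
      with eq[of x0] \<open>w $ x0 < 0\<close> show False by simp
    qed
    then have sup: "markov_op P (\<lambda>y. 0 - Z w y) x \<le> 0 - Z w x" for x
      using eq[of x] unfolding markov_op_diff by simp
    from superharmonic_const[OF irr sup, of _ x0] have Z0: "Z w y = 0" for y by (simp add: Z_def)
    then have "Z w = (\<lambda>_. 0)" by (intro ext)
    with eq[of x0] have "w $ x0 = 0" by simp
    moreover have "w $ y = 0" if "y \<noteq> x0" for y using Z0[of y] that by (simp add: Z_def)
    ultimately show "w = 0" by (metis vec_eq_iff zero_index)
  qed
  have "surj L" using linear_inj_imp_surj[OF lin inj] .
  then obtain w where "L w = (\<chi> x. v x)" by (metis surjD)
  then have "v x = w $ x0 + (Z w x - markov_op P (Z w) x)" for x
    by (simp add: L_def vec_eq_iff)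
  then show ?thesis by (rule that)
qed

lemma sum_funpow_markov_op:
  assumes "\<And>x. v x = c + (u x - markov_op P u x)"
  shows "(\<Sum>t<n. (markov_op P ^^ t) v x) = real n * c + (u x - (markov_op P ^^ n) u x)"
proof (induction n)
  case (Suc n)
  have "v = (\<lambda>x. c + (u x - markov_op P u x))" using assms by (intro ext)
  then have "(markov_op P ^^ n) v x
      = c + ((markov_op P ^^ n) u x - (markov_op P ^^ n) (markov_op P u) x)"
    by (simp only: funpow_markov_op_add funpow_markov_op_diff funpow_markov_op_const)
  with Suc show ?case by (simp add: algebra_simps funpow_swap1)
qed simp

text \<open>The boundary term of the telescoped sum is bounded by \<open>2 * B\<close> and
  disappears after division by \<open>n\<close>.\<close>

lemma cesaro_funpow_markov_op:
  fixes u v :: "'s::finite \<Rightarrow> real"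
  assumes "\<And>x. v x = c + (u x - markov_op P u x)"
  shows "(\<lambda>n. (\<Sum>t<n. (markov_op P ^^ t) v x) / real n) \<longlonglongrightarrow> c"
proof -
  define B where "B = (\<Sum>y\<in>UNIV. \<bar>u y\<bar>)"
  have B: "\<bar>u y\<bar> \<le> B" for y unfolding B_def by (rule member_le_sum) auto
  have "(\<lambda>n. (u x - (markov_op P ^^ n) u x) / real n) \<longlonglongrightarrow> 0"
  proof (rule tendsto_rabs_zero_cancel, rule tendsto_sandwich[of "\<lambda>_. 0" _ _ "\<lambda>n. 2 * B / real n"])
    show "(\<lambda>n. 2 * B / real n) \<longlonglongrightarrow> 0" by (rule lim_const_over_n)
    have "\<bar>u x - (markov_op P ^^ n) u x\<bar> \<le> 2 * B" for n
      using B[of x] funpow_markov_op_abs_le[of u B n P x, OF B] by linarith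
    then show "\<forall>\<^sub>F n in sequentially. \<bar>(u x - (markov_op P ^^ n) u x) / real n\<bar> \<le> 2 * B / real n"
      by (simp add: abs_divide divide_right_mono)
  qed simp_all
  then have "(\<lambda>n. c + (u x - (markov_op P ^^ n) u x) / real n) \<longlonglongrightarrow> c + 0"
    by (intro tendsto_intros)
  moreover have "\<forall>\<^sub>F n in sequentially. c + (u x - (markov_op P ^^ n) u x) / real n
      = (\<Sum>t<n. (markov_op P ^^ t) v x) / real n"
    using eventually_gt_at_top[of 0]
    by eventually_elim (simp add: sum_funpow_markov_op[OF assms] field_simps)
  ultimately show ?thesis
    by (simp add: tendsto_cong)
qed

section \<open>Trajectory laws\<close>

text \<open>The dummy history \<open>\<lambda>_. undefined\<close> is the only point of the product
  over the empty index set. The identity opens marginals on initial segments to the recursion of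
  \<open>C\<close>.\<close>

lemma (in Ionescu_Tulcea) CI_Ico: "CI {0..<n} = C 0 n (\<lambda>_. undefined)"
proof (rule measure_eqI)
  show "sets (CI {0..<n}) = sets (C 0 n (\<lambda>_. undefined))"
    by (simp add: CI_def sets_C)
  fix X assume "X \<in> sets (CI {0..<n})"
  then have X: "X \<in> sets (PiM {0..<n} M)" by (simp add: CI_def)
  then show "emeasure (CI {0..<n}) X = emeasure (C 0 n (\<lambda>_. undefined)) X"
    by (subst emeasure_CI[OF subset_refl X]) (simp add: prod_emb_id X sets.sets_into_space[OF X, unfolded space_PiM])
qed

text \<open>The kernel \<open>P n\<close> is constrained only on \<open>space (PiM {0..<n} M)\<close>, hence the restriction.\<close>

lemma (in Ionescu_Tulcea) nn_integral_lim_component: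
  assumes f [measurable]: "f \<in> borel_measurable (M n)"
  shows "(\<integral>\<^sup>+\<omega>. f (\<omega> n) \<partial>PF.lim) = (\<integral>\<^sup>+\<omega>. \<integral>\<^sup>+z. f z \<partial>P n (restrict \<omega> {0..<n}) \<partial>PF.lim)"
proof -
  note sets_lim = measurable_cong_sets[OF PF.sets_lim refl]
  have R: "(\<lambda>\<omega>. restrict \<omega> {0..<k}) \<in> measurable PF.lim (PiM {0..<k} M)" for k
    by (simp add: sets_lim)
  have comp: "(\<lambda>\<omega>. f (\<omega> n)) \<in> borel_measurable (PiM {0..<Suc n} M)"
    by (rule measurable_compose[OF _ f], rule measurable_component_singleton) simp
  have "(\<integral>\<^sup>+\<omega>. f (\<omega> n) \<partial>PF.lim) = (\<integral>\<^sup>+\<omega>. f (restrict \<omega> {0..<Suc n} n) \<partial>PF.lim)"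
    by simp
  also have "\<dots> = (\<integral>\<^sup>+\<omega>. f (\<omega> n) \<partial>CI {0..<Suc n})"
    by (subst distr_lim[symmetric, OF finite_atLeastLessThan]) (subst nn_integral_distr[OF R], use comp in simp_all)
  \<comment> \<open>The recursion of \<open>C\<close> splits off the last coordinate, which
    \<open>eP n\<close> draws given the earlier ones.\<close>
  also have "\<dots> = (\<integral>\<^sup>+\<omega>. (\<integral>\<^sup>+\<omega>'. f (\<omega>' n) \<partial>eP n \<omega>) \<partial>C 0 n (\<lambda>_. undefined))"
    unfolding CI_Ico C.simps
    by (subst nn_integral_bind[OF comp]) (auto simp: measurable_cong_sets[OF sets_C refl] measurable_eP)
  also have "\<dots> = (\<integral>\<^sup>+\<omega>. (\<integral>\<^sup>+z. f z \<partial>P n \<omega>) \<partial>C 0 n (\<lambda>_. undefined))"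
    by (intro nn_integral_cong) (simp add: space_C nn_integral_eP[OF _ comp])
  also have "\<dots> = (\<integral>\<^sup>+\<omega>. (\<integral>\<^sup>+z. f z \<partial>P n (restrict \<omega> {0..<n})) \<partial>PF.lim)"
    unfolding CI_Ico[symmetric]
    by (subst distr_lim[symmetric, OF finite_atLeastLessThan], subst nn_integral_distr[OF R])
       (auto intro: measurable_compose[OF P nn_integral_measurable_subprob_algebra])
  finally show ?thesis .
qed

text \<open>Testing with indicators turns the preceding formula into an identity of measures, to
  which \<open>integral_bind\<close> applies for signed integrands.\<close>

lemma (in Ionescu_Tulcea) distr_lim_component:
  "distr PF.lim (M n) (\<lambda>\<omega>. \<omega> n) = PF.lim \<bind> (\<lambda>\<omega>. P n (restrict \<omega> {0..<n}))"
proof (rule measure_eqI)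
  note sets_lim = measurable_cong_sets[OF PF.sets_lim refl]
  have space: "space PF.lim = space (PiM UNIV M)" by (rule sets_eq_imp_space_eq[OF PF.sets_lim])
  have K: "(\<lambda>\<omega>. P n (restrict \<omega> {0..<n})) \<in> measurable PF.lim (subprob_algebra (M n))"
    by (rule measurable_compose[OF _ P]) (simp add: sets_lim)
  then show "sets (distr PF.lim (M n) (\<lambda>\<omega>. \<omega> n)) = sets (PF.lim \<bind> (\<lambda>\<omega>. P n (restrict \<omega> {0..<n})))"
    by (subst sets_bind[OF subprob_measurableD(2)[OF K]]) (auto simp: space)
  fix A assume "A \<in> sets (distr PF.lim (M n) (\<lambda>\<omega>. \<omega> n))"
  then have A: "A \<in> sets (M n)" by simp
  have comp: "(\<lambda>\<omega>. \<omega> n) \<in> measurable PF.lim (M n)"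
    by (simp add: sets_lim)
  have "emeasure (distr PF.lim (M n) (\<lambda>\<omega>. \<omega> n)) A = (\<integral>\<^sup>+z. indicator A z \<partial>distr PF.lim (M n) (\<lambda>\<omega>. \<omega> n))"
    using A by simp
  also have "\<dots> = (\<integral>\<^sup>+\<omega>. indicator A (\<omega> n) \<partial>PF.lim)"
    using A by (subst nn_integral_distr[OF comp]) auto
  also have "\<dots> = (\<integral>\<^sup>+\<omega>. \<integral>\<^sup>+z. indicator A z \<partial>P n (restrict \<omega> {0..<n}) \<partial>PF.lim)"
    using A by (intro nn_integral_lim_component) auto
  also have "\<dots> = (\<integral>\<^sup>+z. indicator A z \<partial>(PF.lim \<bind> (\<lambda>\<omega>. P n (restrict \<omega> {0..<n}))))"
    using A by (intro nn_integral_bind[OF _ K, symmetric]) auto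
  also have "\<dots> = emeasure (PF.lim \<bind> (\<lambda>\<omega>. P n (restrict \<omega> {0..<n}))) A"
    using A K by (intro nn_integral_indicator) (subst sets_bind[OF subprob_measurableD(2)[OF K]], auto simp: space)
  finally show "emeasure (distr PF.lim (M n) (\<lambda>\<omega>. \<omega> n)) A
      = emeasure (PF.lim \<bind> (\<lambda>\<omega>. P n (restrict \<omega> {0..<n}))) A" .
qed

section \<open>Integrals and measurability for a single step\<close>

lemma integral_pmf_finite_type:
  fixes h :: "'b::finite \<Rightarrow> real"
  shows "(\<integral>y. h y \<partial>measure_pmf p) = (\<Sum>y\<in>UNIV. pmf p y * h y)"
  by (subst integral_measure_pmf_real[of UNIV]) (auto simp: mult.commute)

lemma integral_bind_pmf_finite_type:
  fixes h :: "'b::finite \<Rightarrow> real"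
  shows "(\<integral>z. h z \<partial>measure_pmf (bind_pmf p k)) = (\<integral>y. (\<integral>z. h z \<partial>k y) \<partial>p)"
  unfolding measure_pmf_bind
proof (rule integral_bind[where K="count_space UNIV" and B'=1])
  show "\<bar>h z\<bar> \<le> (\<Sum>z\<in>UNIV. \<bar>h z\<bar>)" for z by (rule member_le_sum) auto
qed (auto simp: measure_pmf.finite_measure_axioms measure_pmf.emeasure_space_1 measure_pmf.subprob_space_axioms
    space_subprob_algebra intro!: measurable_measure_pmf)

lemma measurable_state_action [measurable]:
  "(\<lambda>z. G (fst z) (fst (snd z))) \<in> borel_measurable (step_space :: ('s::finite \<times> 'a::finite \<times> real) measure)"
proof -
  have "(\<lambda>z. (fst z, fst (snd z))) \<in> measurable (step_space :: ('s \<times> 'a \<times> real) measure)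
      (count_space UNIV \<Otimes>\<^sub>M count_space UNIV)"
    unfolding step_space_def by measurable
  then have "(\<lambda>z. (fst z, fst (snd z))) \<in> measurable (step_space :: ('s \<times> 'a \<times> real) measure)
      (count_space UNIV)"
    by (simp add: pair_measure_countable)
  from measurable_compose[OF this, of "\<lambda>(y, a). G y a" borel] show ?thesis by simp
qed

lemma measurable_reward [measurable]:
  "(\<lambda>z. snd (snd z)) \<in> borel_measurable (step_space :: ('s \<times> 'a \<times> real) measure)"
proof -
  have "(\<lambda>z. snd (snd z)) \<in> measurable (step_space :: ('s \<times> 'a \<times> real) measure) unit_borel"
    unfolding step_space_def by measurable
  then show ?thesis
    by (rule measurable_compose) (simp add: unit_borel_def measurable_restrict_space1)
qed

lemma space_step_space: "z \<in> space step_space \<longleftrightarrow> snd (snd z) \<in> {0..1}"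
  by (cases z) (auto simp: step_space_def unit_borel_def space_pair_measure space_restrict_space)

locale unstructured_mdp =
  fixes lam :: "real measure" and \<phi> :: "('s::finite, 'a::finite) mdp"
  assumes sets_lam: "sets lam = sets unit_borel" and in_unstructured: "\<phi> \<in> unstructured lam"
begin

lemma prob_space_rew: "prob_space (rew \<phi> y a)"
  and sets_rew: "sets (rew \<phi> y a) = sets unit_borel"
proof -
  have "rew \<phi> y a \<in> reward_laws lam"
    using in_unstructured by (simp add: unstructured_def)
  then show "prob_space (rew \<phi> y a)" "sets (rew \<phi> y a) = sets unit_borel"
    by (auto simp: reward_laws_def sets_lam)
qed

lemma measurable_embed: "(\<lambda>r. (y, a, r)) \<in> measurable (rew \<phi> y a) step_space"
  by (simp add: step_space_def measurable_cong_sets[OF sets_rew refl])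

lemma integral_step_kernel:
  fixes F :: "'s \<times> 'a \<times> real \<Rightarrow> real"
  assumes F [measurable]: "F \<in> borel_measurable step_space"
    and bounded: "\<And>z. z \<in> space step_space \<Longrightarrow> \<bar>F z\<bar> \<le> b"
  shows "(\<integral>z. F z \<partial>step_kernel \<phi> \<pi> x t \<omega>)
    = (\<integral>y. (\<integral>a. (\<integral>r. F (y, a, r) \<partial>rew \<phi> y a) \<partial>\<pi> t \<omega> y) \<partial>next_state \<phi> x t \<omega>)"
proof -
  let ?K = "\<lambda>(y, a). distr (rew \<phi> y a) step_space (\<lambda>r. (y, a, r))"
  let ?p = "bind_pmf (next_state \<phi> x t \<omega>) (\<lambda>y. map_pmf (Pair y) (\<pi> t \<omega> y))"
  have K_prob: "prob_space (?K z)" for z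
    using prob_space_rew measurable_embed by (auto split: prod.split intro: prob_space.prob_space_distr)
  have K: "?K \<in> measurable (measure_pmf ?p) (subprob_algebra step_space)"
    using K_prob by (auto simp: space_subprob_algebra prob_space_imp_subprob_space split: prod.split)
  have "(\<integral>z. F z \<partial>step_kernel \<phi> \<pi> x t \<omega>) = (\<integral>q. (\<integral>z. F z \<partial>?K q) \<partial>?p)"
    unfolding step_kernel_def
  proof (rule integral_bind[OF F bounded K])
    show "AE q in ?p. emeasure (?K q) (space (?K q)) \<le> ennreal 1"
      using prob_space.emeasure_space_1[OF K_prob] by simp
  qed (simp_all add: measure_pmf.finite_measure_axioms)
  also have "\<dots> = (\<integral>q. (case q of (y, a) \<Rightarrow> \<integral>r. F (y, a, r) \<partial>rew \<phi> y a) \<partial>?p)"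
    by (intro Bochner_Integration.integral_cong refl) (auto simp: integral_distr[OF measurable_embed F])
  also have "\<dots> = (\<integral>y. (\<integral>a. (\<integral>r. F (y, a, r) \<partial>rew \<phi> y a) \<partial>\<pi> t \<omega> y) \<partial>next_state \<phi> x t \<omega>)"
    by (simp add: integral_bind_pmf_finite_type)
  finally show ?thesis .
qed

section \<open>Expectations along the process under an arbitrary policy\<close>

context
  fixes \<pi> :: "('s, 'a) policy" and x :: 's
  assumes \<pi>: "\<pi> \<in> policies"
begin

interpretation IT: Ionescu_Tulcea "step_kernel \<phi> \<pi> x" "\<lambda>_. step_space"
  by (rule Ionescu_Tulcea_step_kernel[OF sets_lam in_unstructured \<pi>])

interpretation X: prob_space "process \<phi> \<pi> x"
  by (rule prob_space_process[OF sets_lam in_unstructured \<pi>])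

lemma sets_process: "sets (process \<phi> \<pi> x) = sets (PiM UNIV (\<lambda>_. step_space))"
  by (simp add: process_def IT.PF.sets_lim)

lemma measurable_coordinate [measurable]: "(\<lambda>\<omega>. \<omega> t) \<in> measurable (process \<phi> \<pi> x) step_space"
  by (simp add: measurable_cong_sets[OF sets_process refl])

text \<open>Tower property for one coordinate: its law is the mixture of the step kernels over the
  past, and each kernel draws state, action and reward in turn.\<close>

lemma expectation_step:
  fixes F :: "'s \<times> 'a \<times> real \<Rightarrow> real"
  assumes F [measurable]: "F \<in> borel_measurable step_space"
    and bounded: "\<And>z. z \<in> space step_space \<Longrightarrow> \<bar>F z\<bar> \<le> b"
  shows "(\<integral>\<omega>. F (\<omega> t) \<partial>process \<phi> \<pi> x)
    = (\<integral>\<omega>. (\<integral>y. (\<integral>a. (\<integral>r. F (y, a, r) \<partial>rew \<phi> y a) \<partial>\<pi> t (restrict \<omega> {0..<t}) y)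
        \<partial>next_state \<phi> x t (restrict \<omega> {0..<t})) \<partial>process \<phi> \<pi> x)"
proof -
  let ?k = "\<lambda>\<omega>. step_kernel \<phi> \<pi> x t (restrict \<omega> {0..<t})"
  have R: "(\<lambda>\<omega>. restrict \<omega> {0..<t}) \<in> measurable (process \<phi> \<pi> x) (PiM {0..<t} (\<lambda>_. step_space))"
    by (simp add: measurable_cong_sets[OF sets_process refl])
  have K: "?k \<in> measurable (process \<phi> \<pi> x) (subprob_algebra step_space)"
    by (rule measurable_compose[OF R IT.P])
  have "(\<integral>\<omega>. F (\<omega> t) \<partial>process \<phi> \<pi> x) = (\<integral>z. F z \<partial>distr (process \<phi> \<pi> x) step_space (\<lambda>\<omega>. \<omega> t))"
    by (rule integral_distr[symmetric]) measurable
  also have "distr (process \<phi> \<pi> x) step_space (\<lambda>\<omega>. \<omega> t) = process \<phi> \<pi> x \<bind> ?k"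
    unfolding process_def by (rule IT.distr_lim_component)
  also have "(\<integral>z. F z \<partial>(process \<phi> \<pi> x \<bind> ?k)) = (\<integral>\<omega>. (\<integral>z. F z \<partial>?k \<omega>) \<partial>process \<phi> \<pi> x)"
  proof (rule integral_bind[OF F bounded K])
    have "emeasure (?k \<omega>) (space (?k \<omega>)) = 1" if "\<omega> \<in> space (process \<phi> \<pi> x)" for \<omega>
      by (intro prob_space.emeasure_space_1 IT.prob_space_P measurable_space[OF R that])
    then show "AE \<omega> in process \<phi> \<pi> x. emeasure (?k \<omega>) (space (?k \<omega>)) \<le> ennreal 1"
      by (intro AE_I2) simp
  qed (simp_all add: X.finite_measure_axioms)
  finally show ?thesis by (simp add: integral_step_kernel[OF F bounded])
qed

lemma expectation_state:
  "(\<integral>\<omega>. h (state_at t \<omega>) \<partial>process \<phi> \<pi> x)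
    = (\<integral>\<omega>. (\<integral>y. h y \<partial>next_state \<phi> x t (restrict \<omega> {0..<t})) \<partial>process \<phi> \<pi> x)" for h :: "'s \<Rightarrow> real"
proof -
  have "\<bar>h y\<bar> \<le> (\<Sum>y\<in>UNIV. \<bar>h y\<bar>)" for y by (rule member_le_sum) auto
  then show ?thesis
    using expectation_step[of "\<lambda>z. h (fst z)" "\<Sum>y\<in>UNIV. \<bar>h y\<bar>" t]
      measurable_state_action[of "\<lambda>y a. h y"]
    by (simp add: state_at_def prob_space.prob_space[OF prob_space_rew])
qed

lemma expectation_state_0: "(\<integral>\<omega>. h (state_at 0 \<omega>) \<partial>process \<phi> \<pi> x) = h x" for h :: "'s \<Rightarrow> real"
  by (simp add: expectation_state next_state_def X.prob_space)

lemma expectation_state_Suc: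
  "(\<integral>\<omega>. h (state_at (Suc t) \<omega>) \<partial>process \<phi> \<pi> x)
    = (\<integral>\<omega>. (\<Sum>y\<in>UNIV. pmf (trans \<phi> (state_at t \<omega>) (action_at t \<omega>)) y * h y) \<partial>process \<phi> \<pi> x)"
  using expectation_state[of h "Suc t"]
  by (simp add: next_state_def state_at_def action_at_def integral_pmf_finite_type)

lemma integrable_state_action [simp]:
  "integrable (process \<phi> \<pi> x) (\<lambda>\<omega>. G (state_at t \<omega>) (action_at t \<omega>))" for G :: "'s \<Rightarrow> 'a \<Rightarrow> real"
proof (rule X.integrable_const_bound)
  have "\<bar>G y a\<bar> \<le> (\<Sum>(y, a)\<in>UNIV. \<bar>G y a\<bar>)" for y a
    using member_le_sum[of "(y, a)" UNIV "\<lambda>(y, a). \<bar>G y a\<bar>"] by auto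
  then show "AE \<omega> in process \<phi> \<pi> x. norm (G (state_at t \<omega>) (action_at t \<omega>)) \<le> (\<Sum>(y, a)\<in>UNIV. \<bar>G y a\<bar>)"
    by simp
  show "(\<lambda>\<omega>. G (state_at t \<omega>) (action_at t \<omega>)) \<in> borel_measurable (process \<phi> \<pi> x)"
    unfolding state_at_def action_at_def
    by (rule measurable_compose[OF measurable_coordinate measurable_state_action])
qed

lemma integrable_state [simp]: "integrable (process \<phi> \<pi> x) (\<lambda>\<omega>. h (state_at t \<omega>))" for h :: "'s \<Rightarrow> real"
  using integrable_state_action[of "\<lambda>y a. h y"] .

lemma reward_at_bounds: "\<omega> \<in> space (process \<phi> \<pi> x) \<Longrightarrow> reward_at t \<omega> \<in> {0..1}"
  using measurable_space[OF measurable_coordinate, of \<omega> t] space_step_space[of "\<omega> t"]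
  by (simp add: reward_at_def)

lemma integrable_reward [simp]: "integrable (process \<phi> \<pi> x) (reward_at t)"
proof (rule X.integrable_const_bound)
  show "AE \<omega> in process \<phi> \<pi> x. norm (reward_at t \<omega>) \<le> 1"
    using reward_at_bounds by (intro AE_I2) auto
  show "reward_at t \<in> borel_measurable (process \<phi> \<pi> x)"
    unfolding reward_at_def
    by (rule measurable_compose[OF measurable_coordinate measurable_reward])
qed

text \<open>Given state and action, the reward integrates to its mean, so both sides have the same
  expansion by \<open>expectation_step\<close>.\<close>

lemma expectation_reward:
  "(\<integral>\<omega>. reward_at t \<omega> \<partial>process \<phi> \<pi> x)
    = (\<integral>\<omega>. mean_rew \<phi> (state_at t \<omega>) (action_at t \<omega>) \<partial>process \<phi> \<pi> x)"
proof -
  let ?m = "\<lambda>z. mean_rew \<phi> (fst z) (fst (snd z))"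
  have bound: "\<bar>?m z\<bar> \<le> (\<Sum>(y, a)\<in>UNIV. \<bar>mean_rew \<phi> y a\<bar>)" for z
    using member_le_sum[of "(fst z, fst (snd z))" UNIV "\<lambda>(y, a). \<bar>mean_rew \<phi> y a\<bar>"] by auto
  have "(\<integral>\<omega>. snd (snd (\<omega> t)) \<partial>process \<phi> \<pi> x) = (\<integral>\<omega>. ?m (\<omega> t) \<partial>process \<phi> \<pi> x)"
    by (subst expectation_step[OF measurable_reward, of 1],
        force simp: space_step_space,
        subst expectation_step[OF measurable_state_action[of "mean_rew \<phi>"] bound])
       (simp add: mean_rew_def prob_space.prob_space[OF prob_space_rew])
  then show ?thesis by (simp add: reward_at_def state_at_def action_at_def)
qed

text \<open>These bounds keep the supremum in \<open>opt_gain\<close> finite. For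
  \<open>T = 0\<close> the quotient is \<open>0\<close> by convention.\<close>

lemma avg_rew_bounds: "avg_rew \<phi> \<pi> x T \<in> {0..1}"
proof -
  have "(\<integral>\<omega>. (\<Sum>t<T. reward_at t \<omega>) \<partial>process \<phi> \<pi> x) = (\<Sum>t<T. \<integral>\<omega>. reward_at t \<omega> \<partial>process \<phi> \<pi> x)"
    by (rule Bochner_Integration.integral_sum) simp
  moreover have "(\<integral>\<omega>. reward_at t \<omega> \<partial>process \<phi> \<pi> x) \<in> {0..1}" for t
    using reward_at_bounds X.integral_le_const[of "reward_at t" 1] by (auto intro!: integral_nonneg_AE AE_I2)
  then have "(\<Sum>t<T. \<integral>\<omega>. reward_at t \<omega> \<partial>process \<phi> \<pi> x) \<in> {0..real T}"
    using sum_bounded_above[of "{..<T}" "\<lambda>t. \<integral>\<omega>. reward_at t \<omega> \<partial>process \<phi> \<pi> x" 1]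
    by (auto intro!: sum_nonneg)
  ultimately show ?thesis by (auto simp: avg_rew_def divide_le_eq_1)
qed

text \<open>With a function \<open>h\<close> satisfying the optimality inequality, \<open>R\<^sub>t + h(X\<^sub>t\<^sub>+\<^sub>1) - h(X\<^sub>t)\<close> has
  expectation at most \<open>g\<close>, and the sum over \<open>t\<close> telescopes.\<close>

lemma avg_rew_le:
  assumes le: "\<And>y a. bellman \<phi> a h y \<le> g + h y" and T: "0 < T"
  shows "avg_rew \<phi> \<pi> x T \<le> g + 2 * (\<Sum>y\<in>UNIV. \<bar>h y\<bar>) / real T"
proof -
  let ?E = "\<lambda>F. \<integral>\<omega>. F \<omega> \<partial>process \<phi> \<pi> x"
  have step: "?E (reward_at t) + ?E (\<lambda>\<omega>. h (state_at (Suc t) \<omega>)) \<le> g + ?E (\<lambda>\<omega>. h (state_at t \<omega>))" for t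
  proof -
    have "?E (reward_at t) + ?E (\<lambda>\<omega>. h (state_at (Suc t) \<omega>))
        = ?E (\<lambda>\<omega>. bellman \<phi> (action_at t \<omega>) h (state_at t \<omega>))"
      unfolding expectation_reward expectation_state_Suc bellman_def
      by (rule Bochner_Integration.integral_add[symmetric])
         (rule integrable_state_action[of "\<lambda>y a. mean_rew \<phi> y a"]
           integrable_state_action[of "\<lambda>y a. \<Sum>z\<in>UNIV. pmf (trans \<phi> y a) z * h z"])+
    also have "\<dots> \<le> ?E (\<lambda>\<omega>. g + h (state_at t \<omega>))"
      using le by (intro integral_mono integrable_state_action[of "\<lambda>y a. bellman \<phi> a h y"]) auto
    also have "\<dots> = g + ?E (\<lambda>\<omega>. h (state_at t \<omega>))"
      by (subst Bochner_Integration.integral_add) (auto simp: X.prob_space)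
    finally show ?thesis .
  qed
  have abs_le: "\<bar>h y\<bar> \<le> (\<Sum>y\<in>UNIV. \<bar>h y\<bar>)" for y by (rule member_le_sum) auto
  have E_ge: "- (\<Sum>y\<in>UNIV. \<bar>h y\<bar>) \<le> ?E (\<lambda>\<omega>. h (state_at T \<omega>))"
    using abs_le by (intro X.integral_ge_const) (auto simp: abs_le_iff minus_le_iff)
  have "(\<Sum>t<n. ?E (reward_at t)) \<le> real n * g + h x - ?E (\<lambda>\<omega>. h (state_at n \<omega>))" for n
  proof (induction n)
    case 0
    show ?case using expectation_state_0[of h] by simp
  next
    case (Suc n)
    then show ?case using step[of n] by (simp add: algebra_simps)
  qed
  \<comment> \<open>The factor 2 comes from the two boundary terms, \<open>h x\<close> and the
    expectation of \<open>h\<close> at time \<open>T\<close>.\<close>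
  from this[of T] have "(\<Sum>t<T. ?E (reward_at t)) \<le> real T * g + 2 * (\<Sum>y\<in>UNIV. \<bar>h y\<bar>)"
    using abs_le[of x] E_ge by linarith
  moreover have "?E (\<lambda>\<omega>. \<Sum>t<T. reward_at t \<omega>) = (\<Sum>t<T. ?E (reward_at t))"
    by (rule Bochner_Integration.integral_sum) simp
  ultimately show ?thesis
    using T by (simp add: avg_rew_def field_simps)
qed

end

end

section \<open>Gain and bias\<close>

context unstructured_mdp
begin

abbreviation pol_op :: "('s \<Rightarrow> 'a) \<Rightarrow> ('s \<Rightarrow> real) \<Rightarrow> 's \<Rightarrow> real" where
  "pol_op f \<equiv> markov_op (\<lambda>y. trans \<phi> y (f y))"

text \<open>The law of the action in \<open>y\<close> is a point mass at \<open>f y\<close>, so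
  \<open>G y a\<close> and \<open>G y (f y)\<close> have the same one-step expansion.\<close>

lemma expectation_stationary_action:
  fixes G :: "'s \<Rightarrow> 'a \<Rightarrow> real"
  shows "(\<integral>\<omega>. G (state_at t \<omega>) (action_at t \<omega>) \<partial>process \<phi> (stationary f) x)
    = (\<integral>\<omega>. G (state_at t \<omega>) (f (state_at t \<omega>)) \<partial>process \<phi> (stationary f) x)"
proof -
  have bound: "\<bar>H (fst z) (fst (snd z))\<bar> \<le> (\<Sum>(y, a)\<in>UNIV. \<bar>H y a\<bar>)"
    for H :: "'s \<Rightarrow> 'a \<Rightarrow> real" and z :: "'s \<times> 'a \<times> real"
    using member_le_sum[of "(fst z, fst (snd z))" UNIV "\<lambda>(y, a). \<bar>H y a\<bar>"] by auto
  have "(\<integral>\<omega>. H (fst (\<omega> t)) (fst (snd (\<omega> t))) \<partial>process \<phi> (stationary f) x)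
      = (\<integral>\<omega>. (\<integral>y. H y (f y) \<partial>next_state \<phi> x t (restrict \<omega> {0..<t})) \<partial>process \<phi> (stationary f) x)"
    for H :: "'s \<Rightarrow> 'a \<Rightarrow> real"
    by (subst expectation_step[OF stationary_in_policies measurable_state_action[of H] bound])
       (simp add: stationary_def prob_space.prob_space[OF prob_space_rew])
  from this[of G] this[of "\<lambda>y a. G y (f y)"] show ?thesis
    by (simp add: state_at_def action_at_def)
qed

text \<open>Markov property: the last transition is absorbed into the function, which is why
  \<open>h\<close> varies in the induction.\<close>

lemma expectation_stationary_state:
  "(\<integral>\<omega>. h (state_at t \<omega>) \<partial>process \<phi> (stationary f) x) = (pol_op f ^^ t) h x"
proof (induction t arbitrary: h)
  case 0
  show ?case by (simp add: expectation_state_0[OF stationary_in_policies])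
next
  case (Suc t)
  have "(\<integral>\<omega>. h (state_at (Suc t) \<omega>) \<partial>process \<phi> (stationary f) x)
      = (\<integral>\<omega>. pol_op f h (state_at t \<omega>) \<partial>process \<phi> (stationary f) x)"
    unfolding expectation_state_Suc[OF stationary_in_policies] markov_op_def
    by (rule expectation_stationary_action[where G="\<lambda>y a. \<Sum>z\<in>UNIV. pmf (trans \<phi> y a) z * h z"])
  then show ?case by (simp add: Suc funpow_swap1)
qed

lemma expectation_stationary_reward:
  "(\<integral>\<omega>. reward_at t \<omega> \<partial>process \<phi> (stationary f) x) = (pol_op f ^^ t) (\<lambda>y. mean_rew \<phi> y (f y)) x"
  unfolding expectation_reward[OF stationary_in_policies]
    expectation_stationary_action[where G="mean_rew \<phi>"] by (rule expectation_stationary_state)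

lemma avg_rew_stationary:
  "avg_rew \<phi> (stationary f) x T = (\<Sum>t<T. (pol_op f ^^ t) (\<lambda>y. mean_rew \<phi> y (f y)) x) / real T"
  unfolding avg_rew_def
  by (subst Bochner_Integration.integral_sum)
     (simp_all add: integrable_reward[OF stationary_in_policies] expectation_stationary_reward)

lemma avg_rew_stationary_tendsto:
  assumes "\<And>y. mean_rew \<phi> y (f y) = g + (u y - pol_op f u y)"
  shows "avg_rew \<phi> (stationary f) x \<longlonglongrightarrow> g"
  unfolding avg_rew_stationary using cesaro_funpow_markov_op[OF assms] .

lemma gain_eqI:
  assumes "\<And>y. mean_rew \<phi> y (f y) = g + (u y - pol_op f u y)"
  shows "gain \<phi> f x = g"
  unfolding gain_def using avg_rew_stationary_tendsto[OF assms] by (rule limI)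

lemma bellman_eq_pol_op: "bellman \<phi> (f y) h y = mean_rew \<phi> y (f y) + pol_op f h y"
  by (simp add: bellman_def markov_op_def)

text \<open>\<open>gain\<close> is a \<open>lim\<close>, informative only for convergent averages.
  The Poisson equation supplies the convergence, and its constant is the limit from every initial
  state.\<close>

lemma gain_exists:
  assumes "irreducible_chain (\<lambda>y. trans \<phi> y (f y))"
  obtains g u where "\<And>y. mean_rew \<phi> y (f y) = g + (u y - pol_op f u y)" "\<And>x. gain \<phi> f x = g"
    "\<And>x. avg_rew \<phi> (stationary f) x \<longlonglongrightarrow> g"
proof -
  obtain g u where u: "\<And>y. mean_rew \<phi> y (f y) = g + (u y - pol_op f u y)"
    by (rule poisson_solution[OF assms, of "\<lambda>y. mean_rew \<phi> y (f y)"]) (erule that)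
  show ?thesis by (rule that[OF u gain_eqI[OF u] avg_rew_stationary_tendsto[OF u]])
qed

text \<open>If \<open>r - g = (I - P) u\<close>, the partial sums defining the bias are \<open>u - P\<^sup>T u\<close>, and \<open>P\<^sup>T u\<close> has a
  constant Cesaro limit.\<close>

lemma bias_poisson:
  assumes irr: "irreducible_chain (\<lambda>y. trans \<phi> y (f y))"
  shows "bellman \<phi> (f y) (bias \<phi> f) y = gain \<phi> f x + bias \<phi> f y"
proof -
  let ?r = "\<lambda>y. mean_rew \<phi> y (f y)"
  obtain g u where u: "\<And>y. ?r y = g + (u y - pol_op f u y)" and g: "\<And>x. gain \<phi> f x = g"
    by (rule gain_exists[OF irr]) blast
  \<comment> \<open>A second Poisson equation, for \<open>u\<close> itself: its constant
    \<open>c\<close> is the Cesaro limit of the iterates of \<open>u\<close>.\<close>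
  obtain c w where w: "\<And>y. u y = c + (w y - pol_op f w y)"
    by (rule poisson_solution[OF irr, of u]) (erule that)
  have partial: "(\<integral>\<omega>. (\<Sum>t<T. reward_at t \<omega> - gain \<phi> f (state_at t \<omega>)) \<partial>process \<phi> (stationary f) x)
      = u x - (pol_op f ^^ T) u x" for T x
  proof -
    interpret X: prob_space "process \<phi> (stationary f) x"
      by (rule prob_space_process[OF sets_lam in_unstructured stationary_in_policies])
    have "(\<integral>\<omega>. (\<Sum>t<T. reward_at t \<omega> - g) \<partial>process \<phi> (stationary f) x)
        = (\<Sum>t<T. (pol_op f ^^ t) ?r x - g)"
      by (subst Bochner_Integration.integral_sum)
         (simp_all add: integrable_reward[OF stationary_in_policies] expectation_stationary_reward X.prob_space)
    also have "\<dots> = u x - (pol_op f ^^ T) u x"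
      using sum_funpow_markov_op[OF u, where n=T and x=x] by (simp add: sum_subtractf)
    finally show ?thesis by (simp add: g)
  qed
  have bias: "bias \<phi> f x = u x - c" for x
  proof -
    let ?q = "\<lambda>T. (pol_op f ^^ T) u x"
    have avg: "(\<lambda>N. (\<Sum>T<N. ?q T) / real N) \<longlonglongrightarrow> c" by (rule cesaro_funpow_markov_op[OF w])
    \<comment> \<open>\<open>cesaro_lim\<close> sums over \<open>T = 1..N\<close>, while the known
      average starts at \<open>T = 0\<close>. Hence the index shift, the factor
      \<open>(N + 1) / N\<close> and the term \<open>u x / N\<close> for the dropped
      summand.\<close>
    have "(\<lambda>N. u x - ((\<Sum>T<Suc N. ?q T) / real (Suc N)) * (real (Suc N) / real N) + u x / real N)
        \<longlonglongrightarrow> u x - c * 1 + 0"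
      by (intro tendsto_intros LIMSEQ_Suc[OF avg] lim_const_over_n LIMSEQ_Suc_n_over_n)
    moreover have "\<forall>\<^sub>F N in sequentially.
        u x - ((\<Sum>T<Suc N. ?q T) / real (Suc N)) * (real (Suc N) / real N) + u x / real N
          = (\<Sum>T=1..N. u x - ?q T) / real N"
      using eventually_gt_at_top[of 0]
    proof eventually_elim
      case (elim N)
      have "(\<Sum>T<Suc N. ?q T) = u x + (\<Sum>T=1..N. ?q T)"
        using sum.atLeast_Suc_atMost[of 0 N ?q] by (simp add: lessThan_Suc_atMost atLeast0AtMost)
      then have sum: "(\<Sum>T=1..N. u x - ?q T) = real N * u x + u x - (\<Sum>T<Suc N. ?q T)"
        by (simp add: sum_subtractf)
      have "u x - s / real (Suc N) * (real (Suc N) / real N) + u x / real N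
          = (real N * u x + u x - s) / real N" for s
        using elim by (simp add: diff_divide_distrib add_divide_distrib del: of_nat_Suc)
      then show ?case unfolding sum .
    qed
    ultimately have "(\<lambda>N. (\<Sum>T=1..N. u x - ?q T) / real N) \<longlonglongrightarrow> u x - c"
      by (simp add: tendsto_cong)
    then show ?thesis
      unfolding bias_def cesaro_lim_def partial by (rule limI)
  qed
  \<comment> \<open>The bias differs from \<open>u\<close> by a constant, which the transition
    operator preserves, so it inherits the Poisson equation.\<close>
  then have "bias \<phi> f = (\<lambda>y. u y - c)" by (intro ext)
  then show ?thesis
    unfolding bellman_eq_pol_op g by (simp add: u markov_op_diff)
qed

text \<open>Subtracting the Poisson equation of \<open>f\<close>, solved by \<open>u\<close>, turns
  the Bellman residual of any pair \<open>(g, h)\<close> into the gain difference plus a coboundary,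
  with \<open>w = u - h\<close>.\<close>

lemma drift_eq:
  assumes irr: "irreducible_chain (\<lambda>y. trans \<phi> y (f y))"
  obtains w where "\<And>y. bellman \<phi> (f y) h y - (g + h y) = (gain \<phi> f x - g) + (w y - pol_op f w y)"
proof -
  obtain c u where u: "\<And>y. mean_rew \<phi> y (f y) = c + (u y - pol_op f u y)"
      and c: "\<And>x. gain \<phi> f x = c"
    by (rule gain_exists[OF irr]) blast
  show ?thesis
    by (rule that[of "\<lambda>y. u y - h y"]) (simp add: bellman_eq_pol_op u c markov_op_diff)
qed

text \<open>Policy improvement: a nonnegative residual that is positive somewhere forces a positive
  gain difference by \<open>irreducible_drift_pos\<close>.\<close>

lemma gain_greater:
  assumes irr: "irreducible_chain (\<lambda>y. trans \<phi> y (f y))"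
    and ge: "\<And>y. g + h y \<le> bellman \<phi> (f y) h y" and gr: "g + h z < bellman \<phi> (f z) h z"
  shows "g < gain \<phi> f x"
proof -
  obtain w where w: "\<And>y. bellman \<phi> (f y) h y - (g + h y) = (gain \<phi> f x - g) + (w y - pol_op f w y)"
    by (rule drift_eq[OF irr]) (erule that)
  have "0 < gain \<phi> f x - g"
    by (rule irreducible_drift_pos[OF irr, of _ w z]) (use ge gr in \<open>simp_all flip: w\<close>)
  then show ?thesis by simp
qed

lemma gain_less:
  assumes irr: "irreducible_chain (\<lambda>y. trans \<phi> y (f y))"
    and le: "\<And>y. bellman \<phi> (f y) h y \<le> g + h y" and ls: "bellman \<phi> (f z) h z < g + h z"
  shows "gain \<phi> f x < g"
proof -
  obtain w where w: "\<And>y. bellman \<phi> (f y) h y - (g + h y) = (gain \<phi> f x - g) + (w y - pol_op f w y)"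
    by (rule drift_eq[OF irr]) (erule that)
  have neg: "(g - gain \<phi> f x) + (- w y - pol_op f (\<lambda>y. - w y) y) = g + h y - bellman \<phi> (f y) h y" for y
    using w[of y] markov_op_scale[of _ "-1" w y] by simp
  have "0 < g - gain \<phi> f x"
    by (rule irreducible_drift_pos[OF irr, of _ "\<lambda>y. - w y" z]) (use le ls in \<open>simp_all add: neg\<close>)
  then show ?thesis by simp
qed

text \<open>The supremum lies between 0 and 1, so \<open>real_of_ereal\<close> does not hit its
  default value at infinity.\<close>

lemma opt_gain_ereal:
  "ereal (opt_gain \<phi> x) = (SUP \<pi>\<in>policies. liminf (\<lambda>T. ereal (avg_rew \<phi> \<pi> x T)))"
proof -
  let ?S = "SUP \<pi>\<in>policies. liminf (\<lambda>T. ereal (avg_rew \<phi> \<pi> x T))"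
  have "?S \<le> 1"
  proof (rule SUP_least)
    fix \<pi> :: "('s, 'a) policy" assume "\<pi> \<in> policies"
    then have "liminf (\<lambda>T. ereal (avg_rew \<phi> \<pi> x T)) \<le> liminf (\<lambda>T. 1)"
      using avg_rew_bounds by (intro Liminf_mono always_eventually) auto
    then show "liminf (\<lambda>T. ereal (avg_rew \<phi> \<pi> x T)) \<le> 1" by (simp add: Liminf_const)
  qed
  moreover have "0 \<le> ?S"
  proof (rule SUP_upper2[OF stationary_in_policies])
    fix f :: "'s \<Rightarrow> 'a"
    have "liminf (\<lambda>T. 0) \<le> liminf (\<lambda>T. ereal (avg_rew \<phi> (stationary f) x T))"
      using avg_rew_bounds[OF stationary_in_policies] by (intro Liminf_mono always_eventually) auto
    then show "0 \<le> liminf (\<lambda>T. ereal (avg_rew \<phi> (stationary f) x T))" by (simp add: Liminf_const)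
  qed
  ultimately show ?thesis
    unfolding opt_gain_def by (cases ?S) auto
qed

lemma gain_le_opt_gain:
  assumes "irreducible_chain (\<lambda>y. trans \<phi> y (f y))"
  shows "gain \<phi> f x \<le> opt_gain \<phi> x"
proof -
  have "avg_rew \<phi> (stationary f) x \<longlonglongrightarrow> gain \<phi> f x"
    by (rule gain_exists[OF assms]) simp
  then have "(\<lambda>T. ereal (avg_rew \<phi> (stationary f) x T)) \<longlonglongrightarrow> ereal (gain \<phi> f x)" by simp
  then have "liminf (\<lambda>T. ereal (avg_rew \<phi> (stationary f) x T)) = ereal (gain \<phi> f x)"
    by (intro lim_imp_Liminf) simp_all
  then have "ereal (gain \<phi> f x) \<le> ereal (opt_gain \<phi> x)"
    unfolding opt_gain_ereal using stationary_in_policies by (metis SUP_upper)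
  then show ?thesis by simp
qed

text \<open>Verification against all policies, including history-dependent ones: the error term of
  \<open>avg_rew_le\<close> vanishes as \<open>T\<close> grows.\<close>

lemma opt_gain_le:
  assumes le: "\<And>y a. bellman \<phi> a h y \<le> g + h y"
  shows "opt_gain \<phi> x \<le> g"
proof -
  let ?B = "2 * (\<Sum>y\<in>UNIV. \<bar>h y\<bar>)"
  have "(\<lambda>T. g + ?B / real T) \<longlonglongrightarrow> g + 0"
    by (intro tendsto_intros lim_const_over_n)
  then have lim: "liminf (\<lambda>T. ereal (g + ?B / real T)) = ereal g"
    by (intro lim_imp_Liminf) simp_all
  have "ereal (opt_gain \<phi> x) \<le> ereal g"
    unfolding opt_gain_ereal
  proof (rule SUP_least)
    fix \<pi> :: "('s, 'a) policy" assume \<pi>: "\<pi> \<in> policies"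
    have "liminf (\<lambda>T. ereal (avg_rew \<phi> \<pi> x T)) \<le> liminf (\<lambda>T. ereal (g + ?B / real T))"
      by (intro Liminf_mono eventually_mono[OF eventually_gt_at_top[of 0]])
         (simp add: avg_rew_le[OF \<pi> le])
    then show "liminf (\<lambda>T. ereal (avg_rew \<phi> \<pi> x T)) \<le> ereal g" by (simp add: lim)
  qed
  then show ?thesis by simp
qed

text \<open>The probability of being in \<open>y\<close> at time \<open>t\<close> is the
  \<open>t\<close>-th iterate of the indicator of \<open>y\<close>; where it is positive, a path of
  positive transitions leads to \<open>y\<close>.\<close>

lemma ergodic_imp_irreducible:
  assumes "ergodic \<phi>"
  shows "irreducible_chain (\<lambda>y. trans \<phi> y (f y))"
  unfolding irreducible_chain_def
proof (intro allI)
  fix x y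
  let ?R = "{(x, y). 0 < pmf (trans \<phi> x (f x)) y}" and ?e = "indicator {y} :: 's \<Rightarrow> real"
  let ?X = "process \<phi> (stationary f) x"
  have reach: "(z, y) \<in> ?R\<^sup>*" if "0 < (pol_op f ^^ t) ?e z" for t z
    using that
  proof (induction t arbitrary: z)
    case 0
    then show ?case by (auto simp: indicator_def split: if_splits)
  next
    case (Suc t)
    have "0 < (\<Sum>v\<in>UNIV. pmf (trans \<phi> z (f z)) v * (pol_op f ^^ t) ?e v)"
      using Suc.prems unfolding funpow.simps comp_apply by (subst (asm) markov_op_def)
    then obtain v where v: "0 < pmf (trans \<phi> z (f z)) v * (pol_op f ^^ t) ?e v"
      using sum_nonpos[of UNIV "\<lambda>v. pmf (trans \<phi> z (f z)) v * (pol_op f ^^ t) ?e v"]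
      by (auto simp flip: not_le)
    have "0 < pmf (trans \<phi> z (f z)) v" "0 < (pol_op f ^^ t) ?e v"
      using v pmf_nonneg[of "trans \<phi> z (f z)" v] by (auto simp: zero_less_mult_iff)
    with Suc.IH[of v] show ?case by (auto intro: converse_rtrancl_into_rtrancl)
  qed
  obtain t where t: "0 < measure ?X {\<omega> \<in> space ?X. state_at t \<omega> = y}"
    using assms unfolding ergodic_def by blast
  have "(pol_op f ^^ t) ?e x = (\<integral>\<omega>. ?e (state_at t \<omega>) \<partial>?X)"
    by (rule expectation_stationary_state[symmetric])
  also have "\<dots> = (\<integral>\<omega>. indicator {\<omega> \<in> space ?X. state_at t \<omega> = y} \<omega> \<partial>?X)"
    by (intro Bochner_Integration.integral_cong refl) (auto simp: indicator_def)
  also have "\<dots> = measure ?X {\<omega> \<in> space ?X. state_at t \<omega> = y}"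
    by (simp add: Int_absorb2 subset_iff)
  finally have "0 < (pol_op f ^^ t) ?e x" using t by simp
  then show "(x, y) \<in> ?R\<^sup>*" by (rule reach)
qed

end

section \<open>Optimality equation and optimal actions\<close>

locale ergodic_mdp = unstructured_mdp lam \<phi>
  for lam and \<phi> :: "('s::finite, 'a::finite) mdp" +
  assumes irreducible: "irreducible_chain (\<lambda>y. trans \<phi> y (f y))"
begin

text \<open>\<open>opt_gain\<close> is squeezed between the gain of \<open>f\<close> and the bound
  that \<open>h\<close> certifies for every policy.\<close>

lemma opt_policyI:
  assumes "\<And>y a. bellman \<phi> a h y \<le> g + h y" "\<And>y. gain \<phi> f y = g"
  shows "f \<in> opt_policies \<phi>" "opt_gain \<phi> x = g"
proof -
  have "opt_gain \<phi> x = g" for x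
    using gain_le_opt_gain[OF irreducible, of f x] opt_gain_le[of h g x] assms by (simp add: antisym)
  then show "f \<in> opt_policies \<phi>" "opt_gain \<phi> x = g" by (auto simp: opt_policies_def assms)
qed

text \<open>Otherwise, switching to \<open>a\<close> in the state \<open>x\<close> would improve the gain of \<open>f\<close>.\<close>

lemma max_gain_bellman_le:
  assumes f: "\<And>y. bellman \<phi> (f y) h y = g + h y" and max: "\<And>f' x. gain \<phi> f' x \<le> g"
  shows "bellman \<phi> a h x \<le> g + h x"
proof (rule ccontr)
  assume "\<not> bellman \<phi> a h x \<le> g + h x"
  then have "g < gain \<phi> (f(x := a)) x"
    by (intro gain_greater[OF irreducible, of g h _ x]) (auto simp: f less_imp_le)
  with max[of "f(x := a)" x] show False by simp
qed

lemma gain_const: "gain \<phi> f x = gain \<phi> f y"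
  by (rule gain_exists[OF irreducible, of f]) simp

text \<open>One of the finitely many stationary policies has maximal gain. Its bias then satisfies
  the optimality inequality, so no history-dependent policy beats it.\<close>

lemma opt_policies_nonempty: "opt_policies \<phi> \<noteq> {}"
proof -
  define z :: 's where "z = undefined"
  have "Max (range (\<lambda>f. gain \<phi> f z)) \<in> range (\<lambda>f. gain \<phi> f z)" by (intro Max_in) auto
  then obtain f where f: "Max (range (\<lambda>f. gain \<phi> f z)) = gain \<phi> f z" by (rule imageE)
  have max: "gain \<phi> f' x \<le> gain \<phi> f z" for f' x
    unfolding f[symmetric] gain_const[of f' x z] by simp
  have "f \<in> opt_policies \<phi>"
    by (rule opt_policyI(1)[OF max_gain_bellman_le[OF bias_poisson[OF irreducible] max] gain_const])
  then show ?thesis by auto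
qed

text \<open>Existence of an optimal policy makes the choice in \<open>opt_bias\<close> genuine; the
  equation is the Poisson equation of the chosen policy.\<close>

lemma optimality_equation:
  obtains f where "f \<in> opt_policies \<phi>" and "\<And>y. bellman \<phi> (f y) (opt_bias \<phi>) y = opt_gain \<phi> x + opt_bias \<phi> y"
    and "\<And>y. gain \<phi> f y = opt_gain \<phi> x"
proof -
  define f where "f = (SOME f. f \<in> opt_policies \<phi>)"
  have f: "f \<in> opt_policies \<phi>"
    using opt_policies_nonempty unfolding f_def by (simp add: some_in_eq)
  have opt: "opt_bias \<phi> = bias \<phi> f" by (simp add: opt_bias_def f_def)
  have g: "gain \<phi> f y = opt_gain \<phi> x" for y
    using f gain_const[of f y x] by (auto simp: opt_policies_def)
  show ?thesis
    by (rule that[OF f]) (use bias_poisson[OF irreducible, of f _ x] g opt in auto)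
qed

lemma opt_gain_const: "opt_gain \<phi> x = opt_gain \<phi> y"
  using optimality_equation[of x] by (auto simp: opt_policies_def)

lemma bellman_opt_bias_le: "bellman \<phi> a (opt_bias \<phi>) y \<le> opt_gain \<phi> x + opt_bias \<phi> y"
proof -
  obtain f where f: "\<And>y. bellman \<phi> (f y) (opt_bias \<phi>) y = opt_gain \<phi> x + opt_bias \<phi> y"
    using optimality_equation by metis
  have "gain \<phi> f' z \<le> opt_gain \<phi> x" for f' z
    using gain_le_opt_gain[OF irreducible] opt_gain_const by metis
  from max_gain_bellman_le[OF f this] show ?thesis .
qed

lemma opt_actions_iff: "a \<in> opt_actions \<phi> y \<longleftrightarrow> bellman \<phi> a (opt_bias \<phi>) y = opt_gain \<phi> x + opt_bias \<phi> y"
proof -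
  obtain f where f: "\<And>y. bellman \<phi> (f y) (opt_bias \<phi>) y = opt_gain \<phi> x + opt_bias \<phi> y"
    using optimality_equation by metis
  have "bellman_opt \<phi> (opt_bias \<phi>) y = opt_gain \<phi> x + opt_bias \<phi> y"
    unfolding bellman_opt_def
    by (rule Max_eqI) (use bellman_opt_bias_le[of _ y x] f[of y] in \<open>auto intro: range_eqI[OF sym]\<close>)
  then show ?thesis by (auto simp: opt_actions_def)
qed

text \<open>A non-optimal action in \<open>y\<close> gives a residual that is negative at
  \<open>y\<close> and nowhere positive, hence a strictly smaller gain.\<close>

lemma opt_policies_opt_actions:
  assumes "f \<in> opt_policies \<phi>"
  shows "f y \<in> opt_actions \<phi> y"
proof (rule ccontr)
  assume "f y \<notin> opt_actions \<phi> y"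
  then have "bellman \<phi> (f y) (opt_bias \<phi>) y < opt_gain \<phi> y + opt_bias \<phi> y"
    using bellman_opt_bias_le[of "f y" y y] by (auto simp: opt_actions_iff[of _ _ y])
  then have "gain \<phi> f y < opt_gain \<phi> y"
    by (rule gain_less[OF irreducible bellman_opt_bias_le])
  with assms show False by (simp add: opt_policies_def)
qed

end

section \<open>Divergence\<close>

text \<open>This is \<open>ln t \<le> t - 1\<close> at \<open>t = q / p\<close>. The bound
  \<open>p - q\<close> has total 0 for probability densities, whence nonnegative divergence.\<close>

lemma mult_ln_divide_ge:
  fixes p q :: real
  assumes "0 \<le> p" "0 \<le> q" "q = 0 \<longrightarrow> p = 0"
  shows "p - q \<le> p * ln (p / q)"
proof (cases "p = 0")
  case False
  with assms have pos: "0 < p" "0 < q" by auto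
  then have "p * ln (q / p) \<le> p * (q / p - 1)"
    by (intro mult_left_mono ln_le_minus_one) auto
  also have "\<dots> = q - p" using pos by (simp add: field_simps)
  finally show ?thesis using pos by (simp add: ln_div algebra_simps)
qed (use assms in auto)

lemma mult_ln_divide_eq:
  fixes p q :: real
  assumes "0 \<le> p" "0 \<le> q" "q = 0 \<longrightarrow> p = 0" and eq: "p * ln (p / q) = p - q"
  shows "p = q"
proof (cases "p = 0")
  case False
  with assms have pos: "0 < p" "0 < q" by auto
  have "p * (q / p - 1) = q - p" using pos by (simp add: field_simps)
  also have "\<dots> = p * ln (q / p)" using pos eq by (simp add: ln_div algebra_simps)
  finally have "p * ln (q / p) = p * (q / p - 1)" ..
  then have "ln (q / p) = q / p - 1" using pos by simp
  then have "q / p = 1" using pos by (intro ln_eq_minus_one) auto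
  then show ?thesis using pos by simp
qed (use assms in auto)

lemma pmf_eq_0_absolutely_continuous:
  assumes "absolutely_continuous (measure_pmf q) (measure_pmf p)" "pmf q y = 0"
  shows "pmf p y = 0"
proof -
  have "{y} \<in> null_sets (measure_pmf q)" using assms(2) by (simp add: null_sets_def emeasure_pmf_single)
  then have "{y} \<in> null_sets (measure_pmf p)" using assms(1) by (auto simp: absolutely_continuous_def)
  then show ?thesis by (simp add: null_sets_def emeasure_pmf_single)
qed

text \<open>Gibbs' inequality. If the divergence is 0, the nonnegative termwise excesses over
  \<open>p - q\<close> all vanish, which is the equality case of the logarithm bound.\<close>

lemma pmf_divergence_nonneg:
  fixes p q :: "'s::finite pmf"
  assumes "absolutely_continuous (measure_pmf q) (measure_pmf p)"
  shows "0 \<le> (\<Sum>y\<in>UNIV. pmf p y * ln (pmf p y / pmf q y))" (is "0 \<le> ?D")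
    and "(\<Sum>y\<in>UNIV. pmf p y * ln (pmf p y / pmf q y)) = 0 \<Longrightarrow> p = q"
proof -
  have ac: "pmf q y = 0 \<longrightarrow> pmf p y = 0" for y
    using pmf_eq_0_absolutely_continuous[OF assms] by blast
  have ge: "pmf p y - pmf q y \<le> pmf p y * ln (pmf p y / pmf q y)" for y
    using ac by (intro mult_ln_divide_ge) auto
  have sum0: "(\<Sum>y\<in>UNIV. pmf p y - pmf q y) = 0" by (simp add: sum_subtractf)
  then show "0 \<le> ?D" using sum_mono[of UNIV "\<lambda>y. pmf p y - pmf q y", OF ge] by simp
  assume "?D = 0"
  with sum0 have "(\<Sum>y\<in>UNIV. pmf p y * ln (pmf p y / pmf q y) - (pmf p y - pmf q y)) = 0"
    by (simp add: sum_subtractf)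
  then have "pmf p y * ln (pmf p y / pmf q y) = pmf p y - pmf q y" for y
    using ge by (subst (asm) sum_nonneg_eq_0_iff) auto
  from mult_ln_divide_eq[OF pmf_nonneg pmf_nonneg ac this] have "pmf p y = pmf q y" for y .
  then show "p = q" by (intro pmf_eqI)
qed

text \<open>The derivative integrates to 1, hence is finite almost everywhere, and
  \<open>enn2real\<close> changes it only on a null set.\<close>

lemma density_rew_dens:
  assumes "rew \<phi> x a \<in> reward_laws lam"
  shows "density lam (\<lambda>r. ennreal (rew_dens lam \<phi> x a r)) = rew \<phi> x a"
    and "(\<integral>\<^sup>+r. ennreal (rew_dens lam \<phi> x a r) \<partial>lam) = 1"
proof -
  from assms interpret prob_space "rew \<phi> x a" by (simp add: reward_laws_def)
  let ?f = "RN_deriv lam (rew \<phi> x a)"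
  from assms have d: "density lam ?f = rew \<phi> x a"
    by (auto simp: reward_laws_def intro: density_RN_deriv_density)
  have "integral\<^sup>N lam ?f = emeasure (density lam ?f) (space lam)"
    by (simp add: emeasure_density cong: nn_integral_cong)
  also have "\<dots> = 1" by (metis d emeasure_space_1 space_density)
  finally have int: "integral\<^sup>N lam ?f = 1" .
  then have "AE r in lam. ?f r \<noteq> \<infinity>" by (intro nn_integral_PInf_AE) auto
  then have eq: "AE r in lam. ?f r = ennreal (rew_dens lam \<phi> x a r)"
    by eventually_elim (simp add: rew_dens_def less_top)
  have "density lam (\<lambda>r. ennreal (rew_dens lam \<phi> x a r)) = density lam ?f"
    by (rule density_cong) (use eq in \<open>auto simp: rew_dens_def\<close>)
  with d show "density lam (\<lambda>r. ennreal (rew_dens lam \<phi> x a r)) = rew \<phi> x a" by simp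
  show "(\<integral>\<^sup>+r. ennreal (rew_dens lam \<phi> x a r) \<partial>lam) = 1"
    using int nn_integral_cong_AE[OF eq] by simp
qed

lemma borel_measurable_rew_dens [measurable]: "rew_dens lam \<phi> x a \<in> borel_measurable lam"
  unfolding rew_dens_def by measurable

text \<open>Gibbs' inequality for densities. The positive part may have infinite integral, so both
  parts are compared in \<open>ennreal\<close>; Bochner integrals enter only in the equality
  case.\<close>

lemma density_divergence_nonneg:
  fixes f g :: "'b \<Rightarrow> real"
  assumes [measurable]: "f \<in> borel_measurable M" "g \<in> borel_measurable M"
    and nn: "\<And>z. 0 \<le> f z" "\<And>z. 0 \<le> g z"
    and f1: "(\<integral>\<^sup>+z. ennreal (f z) \<partial>M) = 1" and g1: "(\<integral>\<^sup>+z. ennreal (g z) \<partial>M) = 1"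
    and ac: "absolutely_continuous (density M (\<lambda>z. ennreal (g z))) (density M (\<lambda>z. ennreal (f z)))"
  shows "0 \<le> ext_integral M (\<lambda>z. f z * ln (f z / g z))"
    and "ext_integral M (\<lambda>z. f z * ln (f z / g z)) = 0 \<Longrightarrow> AE z in M. f z = g z"
proof -
  define F where "F z = f z * ln (f z / g z)" for z
  have [measurable]: "F \<in> borel_measurable M" unfolding F_def by measurable
  define Z where "Z = {z \<in> space M. g z = 0}"
  have Z [measurable]: "Z \<in> sets M" unfolding Z_def by measurable
  have "Z \<in> null_sets (density M (\<lambda>z. ennreal (g z)))"
    by (subst null_sets_density_iff) (auto simp: Z_def)
  then have "Z \<in> null_sets (density M (\<lambda>z. ennreal (f z)))"
    using ac by (auto simp: absolutely_continuous_def)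
  then have "AE z in M. z \<in> Z \<longrightarrow> ennreal (f z) = 0"
    by (subst (asm) null_sets_density_iff) auto
  then have ac': "AE z in M. g z = 0 \<longrightarrow> f z = 0"
    using AE_space by eventually_elim (use nn in \<open>auto simp: Z_def ennreal_eq_0_iff antisym\<close>)
  then have ge: "AE z in M. f z - g z \<le> F z"
    unfolding F_def by eventually_elim (intro mult_ln_divide_ge nn)
  let ?P = "\<integral>\<^sup>+z. ennreal (F z) \<partial>M" and ?N = "\<integral>\<^sup>+z. ennreal (- F z) \<partial>M"
  \<comment> \<open>\<open>- F \<le> g - f \<le> g\<close> makes the negative part finite, which
    excludes \<open>\<infinity> - \<infinity>\<close>.\<close>
  have "?N \<le> (\<integral>\<^sup>+z. ennreal (g z) \<partial>M)"
  proof (rule nn_integral_mono_AE, use ge in eventually_elim)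
    fix z assume "f z - g z \<le> F z"
    then show "ennreal (- F z) \<le> ennreal (g z)" using nn[of z] by (intro ennreal_leI) linarith
  qed
  then have N_le: "?N \<le> 1" by (simp add: g1)
  \<comment> \<open>\<open>F \<ge> f - g\<close> is rearranged so that only sums of nonnegative
    terms are integrated.\<close>
  have "?N + 1 = (\<integral>\<^sup>+z. ennreal (- F z) + ennreal (f z) \<partial>M)"
    by (subst nn_integral_add) (auto simp: f1)
  also have "\<dots> \<le> (\<integral>\<^sup>+z. ennreal (F z) + ennreal (g z) \<partial>M)"
  proof (rule nn_integral_mono_AE, use ge in eventually_elim)
    fix z assume le: "f z - g z \<le> F z"
    have "max 0 (- F z) + f z \<le> max 0 (F z) + g z" using le nn[of z] by (auto simp: max_def)
    then have "ennreal (max 0 (- F z) + f z) \<le> ennreal (max 0 (F z) + g z)" by (rule ennreal_leI)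
    then show "ennreal (- F z) + ennreal (f z) \<le> ennreal (F z) + ennreal (g z)"
      using nn[of z] by (simp add: ennreal_plus ennreal_max_0)
  qed
  also have "\<dots> = ?P + 1" by (subst nn_integral_add) (auto simp: g1)
  finally have "?N + 1 \<le> ?P + 1" .
  then have NP: "?N \<le> ?P"
    unfolding add.commute[of _ 1] by (simp add: ennreal_add_left_cancel_le)
  have N_fin: "\<bar>enn2ereal ?N\<bar> \<noteq> \<infinity>"
  proof -
    have "enn2ereal ?N \<le> 1" using N_le by (simp only: less_eq_ennreal.rep_eq one_ennreal.rep_eq)
    then show ?thesis using enn2ereal_nonneg[of ?N] by (intro ereal_infinity_cases) auto
  qed
  show "0 \<le> ext_integral M (\<lambda>z. f z * ln (f z / g z))"
    unfolding F_def[symmetric] ext_integral_def using NP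
    by (intro ereal_diff_positive) (simp only: less_eq_ennreal.rep_eq)
  assume "ext_integral M (\<lambda>z. f z * ln (f z / g z)) = 0"
  then have diff: "enn2ereal ?P - enn2ereal ?N = 0" by (simp only: F_def ext_integral_def)
  have "p = n" if "p - n = 0" "\<bar>n\<bar> \<noteq> \<infinity>" for p n :: ereal
    using that by (cases p; cases n) auto
  from this[OF diff N_fin] have PN: "?P = ?N" by (simp only: enn2ereal_inject)
  \<comment> \<open>Both parts are now equal and finite, so \<open>F - (f - g)\<close> is
    integrable, nonnegative almost everywhere and has integral 0.\<close>
  have int: "integrable M F"
    using PN N_le by (subst real_integrable_def) (auto simp: top_unique)
  have int_fg: "integrable M f" "integrable M g"
    using f1 g1 nn by (auto intro!: integrableI_nonneg)
  have "integral\<^sup>L M f = 1" "integral\<^sup>L M g = 1"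
    using f1 g1 nn by (auto simp: integral_eq_nn_integral)
  moreover have "integral\<^sup>L M F = 0"
    using PN by (subst real_lebesgue_integral_def[OF int]) simp
  ultimately have "(\<integral>z. F z - (f z - g z) \<partial>M) = 0" using int int_fg by simp
  then have "AE z in M. F z = f z - g z"
    using int int_fg ge by (subst (asm) integral_nonneg_eq_0_iff_AE) auto
  with ac' show "AE z in M. f z = g z"
  proof eventually_elim
    fix z assume "g z = 0 \<longrightarrow> f z = 0" "F z = f z - g z"
    from mult_ln_divide_eq[OF nn this[unfolded F_def]] show "f z = g z" .
  qed
qed

text \<open>Both summands are nonnegative, so a zero sum makes both vanish; densities equal almost
  everywhere define the same law.\<close>

lemma KL_nonneg:
  fixes \<phi> \<psi> :: "('s::finite, 'a::finite) mdp"
  assumes "\<phi> \<in> unstructured lam" "\<psi> \<in> unstructured lam" "\<phi> \<lless> \<psi>"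
  shows "0 \<le> KL lam \<phi> \<psi> x a"
    and "KL lam \<phi> \<psi> x a = 0 \<Longrightarrow> trans \<phi> x a = trans \<psi> x a \<and> rew \<phi> x a = rew \<psi> x a"
proof -
  have laws: "rew \<phi> x a \<in> reward_laws lam" "rew \<psi> x a \<in> reward_laws lam"
    using assms by (auto simp: unstructured_def)
  note dens = density_rew_dens[OF laws(1)] density_rew_dens[OF laws(2)]
  have nn: "0 \<le> rew_dens lam \<theta> x a r" for \<theta> r by (simp add: rew_dens_def)
  let ?E = "ext_integral lam
    (\<lambda>r. rew_dens lam \<phi> x a r * ln (rew_dens lam \<phi> x a r / rew_dens lam \<psi> x a r))"
  let ?D = "\<Sum>y\<in>UNIV. pmf (trans \<phi> x a) y * ln (pmf (trans \<phi> x a) y / pmf (trans \<psi> x a) y)"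
  have ac: "absolutely_continuous (measure_pmf (trans \<psi> x a)) (measure_pmf (trans \<phi> x a))"
    "absolutely_continuous (rew \<psi> x a) (rew \<phi> x a)"
    using assms(3) by (auto simp: mdp_abs_cont_def)
  have E: "0 \<le> ?E" "?E = 0 \<Longrightarrow> AE r in lam. rew_dens lam \<phi> x a r = rew_dens lam \<psi> x a r"
    by (rule density_divergence_nonneg; use dens nn ac in simp)+
  have D: "0 \<le> ?D" "?D = 0 \<Longrightarrow> trans \<phi> x a = trans \<psi> x a"
    using pmf_divergence_nonneg[OF ac(1)] by auto
  show "0 \<le> KL lam \<phi> \<psi> x a" using E(1) D(1) by (simp add: KL_def)
  assume "KL lam \<phi> \<psi> x a = 0"
  then have z: "ereal ?D + ?E = 0" by (simp add: KL_def)
  with E(1) D(1) have "?D = 0" "?E = 0" by (cases ?E; simp)+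
  then have eq: "trans \<phi> x a = trans \<psi> x a"
    and ae: "AE r in lam. rew_dens lam \<phi> x a r = rew_dens lam \<psi> x a r" using E D by auto
  have "density lam (\<lambda>r. ennreal (rew_dens lam \<phi> x a r)) = density lam (\<lambda>r. ennreal (rew_dens lam \<psi> x a r))"
    by (rule density_cong) (use ae in auto)
  with eq dens show "trans \<phi> x a = trans \<psi> x a \<and> rew \<phi> x a = rew \<psi> x a" by simp
qed

lemma KL_same:
  assumes "trans \<psi> x a = trans \<phi> x a" "rew \<psi> x a = rew \<phi> x a"
  shows "KL lam \<phi> \<psi> x a = 0"
proof -
  have 0: "p * ln (p / p) = 0" for p :: real by (cases "p = 0") auto
  show ?thesis unfolding KL_def rew_dens_def assms 0 by (simp add: ext_integral_def zero_ereal_def zero_ennreal.rep_eq)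
qed

section \<open>Single-pair modifications\<close>

lemma irreducible_chain_mono:
  assumes "irreducible_chain P" and "\<And>x y. 0 < pmf (P x) y \<Longrightarrow> 0 < pmf (Q x) y"
  shows "irreducible_chain Q"
proof -
  have "{(x, y). 0 < pmf (P x) y}\<^sup>* \<subseteq> {(x, y). 0 < pmf (Q x) y}\<^sup>*"
    using assms(2) by (intro rtrancl_mono) auto
  with assms(1) show ?thesis by (auto simp: irreducible_chain_def)
qed

lemma ergodic_mdp_abs_cont:
  assumes "ergodic_mdp lam \<phi>" "\<psi> \<in> unstructured lam" "\<phi> \<lless> \<psi>"
  shows "ergodic_mdp lam \<psi>"
proof -
  interpret ergodic_mdp lam \<phi> by fact
  show ?thesis
  proof
    fix f
    have "0 < pmf (trans \<psi> x a) y" if "0 < pmf (trans \<phi> x a) y" for x a y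
      using that pmf_eq_0_absolutely_continuous[of "trans \<psi> x a" "trans \<phi> x a" y] assms(3)
      by (metis less_irrefl mdp_abs_cont_def pmf_pos)
    then show "irreducible_chain (\<lambda>y. trans \<psi> y (f y))"
      by (intro irreducible_chain_mono[OF irreducible[of f]])
  qed (use sets_lam assms in auto)
qed

lemma bellman_cong:
  "trans \<phi> x a = trans \<psi> x a \<Longrightarrow> rew \<phi> x a = rew \<psi> x a \<Longrightarrow> bellman \<phi> a h x = bellman \<psi> a h x"
  by (simp add: bellman_def mean_rew_def)

context ergodic_mdp
begin

text \<open>Off \<open>(x, a)\<close> the two models coincide, so an optimal policy of \<phi> keeps
  its gain in \<psi>, while switching to \<open>a\<close> in \<open>x\<close> gains strictly
  more.\<close>

lemma confusing_at_subset_confusing: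
  assumes x: "a \<notin> opt_actions \<phi> x" and \<psi>: "\<psi> \<in> confusing_at lam (unstructured lam) x a \<phi>"
  shows "\<psi> \<in> confusing lam (unstructured lam) \<phi>"
proof -
  let ?h = "opt_bias \<phi>" and ?g = "opt_gain \<phi> x"
  from \<psi> have un: "\<psi> \<in> unstructured lam" and ac: "\<phi> \<lless> \<psi>"
    and KL0: "\<And>y b. (y, b) \<noteq> (x, a) \<Longrightarrow> KL lam \<phi> \<psi> y b = 0"
    and gr: "?g + ?h x < bellman \<psi> a ?h x" by (auto simp: confusing_at_def)
  interpret psi: ergodic_mdp lam \<psi>
    by (rule ergodic_mdp_abs_cont[OF ergodic_mdp_axioms un ac])
  have eq: "bellman \<psi> b ?h y = bellman \<phi> b ?h y" if "(y, b) \<noteq> (x, a)" for y b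
    using KL_nonneg(2)[OF in_unstructured un ac KL0[OF that]] by (intro bellman_cong) auto
  have "f \<notin> opt_policies \<psi>" if f: "f \<in> opt_policies \<phi>" for f
  proof
    assume opt: "f \<in> opt_policies \<psi>"
    have act: "f y \<in> opt_actions \<phi> y" for y by (rule opt_policies_opt_actions[OF f])
    have "f x \<noteq> a" using act[of x] x by auto
    then have f_eq: "bellman \<psi> (f y) ?h y = ?g + ?h y" for y
      using act[of y] eq[of y "f y"] by (auto simp: opt_actions_iff[of _ _ x])
    let ?f' = "f(x := a)"
    have "?g < gain \<psi> ?f' x"
      by (rule psi.gain_greater[OF psi.irreducible, of _ ?h _ x]) (use f_eq gr in \<open>auto intro: less_imp_le\<close>)
    also have "\<dots> \<le> opt_gain \<psi> x" by (rule psi.gain_le_opt_gain[OF psi.irreducible])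
    also have "\<dots> = gain \<psi> f x" using opt by (simp add: opt_policies_def)
    \<comment> \<open>\<open>f\<close> avoids \<open>a\<close> in \<open>x\<close>, so
      \<open>?h\<close> still solves its Poisson equation in \<psi>.\<close>
    also have "\<dots> = ?g"
      using f_eq by (intro psi.gain_eqI[of _ _ ?h]) (simp add: psi.bellman_eq_pol_op algebra_simps)
    finally show False by simp
  qed
  moreover have "KL lam \<phi> \<psi> y b = 0" if "b \<in> opt_actions \<phi> y" for y b
    using that x by (intro KL0) auto
  ultimately show ?thesis using un ac by (auto simp: confusing_def)
qed

text \<open>Some single pair must be responsible for the confusion, and the divergence at a pair
  depends only on the kernels there, so isolating the pair preserves it.\<close>

lemma confusing_imp_confusing_at:
  assumes \<psi>: "\<psi> \<in> confusing lam (unstructured lam) \<phi>"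
  obtains x a \<psi>' where "a \<notin> opt_actions \<phi> x" "\<psi>' \<in> confusing_at lam (unstructured lam) x a \<phi>"
    "KL lam \<phi> \<psi>' x a = KL lam \<phi> \<psi> x a"
proof -
  let ?h = "opt_bias \<phi>"
  define g where "g = opt_gain \<phi> undefined"
  have g: "opt_gain \<phi> x = g" for x unfolding g_def by (rule opt_gain_const)
  from \<psi> have un: "\<psi> \<in> unstructured lam" and ac: "\<phi> \<lless> \<psi>"
    and KL0: "\<And>y b. b \<in> opt_actions \<phi> y \<Longrightarrow> KL lam \<phi> \<psi> y b = 0"
    and disj: "opt_policies \<phi> \<inter> opt_policies \<psi> = {}" by (auto simp: confusing_def)
  interpret psi: ergodic_mdp lam \<psi>
    by (rule ergodic_mdp_abs_cont[OF ergodic_mdp_axioms un ac])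
  have eq: "bellman \<psi> b ?h y = g + ?h y" if "b \<in> opt_actions \<phi> y" for y b
  proof -
    have "bellman \<psi> b ?h y = bellman \<phi> b ?h y"
      using KL_nonneg(2)[OF in_unstructured un ac KL0[OF that]] by (intro bellman_cong) auto
    with that show ?thesis by (simp add: opt_actions_iff[of _ _ undefined] g)
  qed
  \<comment> \<open>Otherwise \<open>?h\<close> certifies \<open>g\<close> as an upper bound in
    \<psi>, and an optimal policy of \<phi>, whose gain is unchanged, is optimal in \<psi>
    too.\<close>
  have "\<exists>x a. g + ?h x < bellman \<psi> a ?h x"
  proof (rule ccontr)
    assume "\<not> ?thesis"
    then have le: "bellman \<psi> a ?h y \<le> g + ?h y" for y a by (auto simp: not_less)
    obtain f where f: "f \<in> opt_policies \<phi>" using opt_policies_nonempty by blast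
    have "gain \<psi> f y = g" for y
      using eq[OF opt_policies_opt_actions[OF f]]
      by (intro psi.gain_eqI[of _ _ ?h]) (simp add: psi.bellman_eq_pol_op algebra_simps)
    with le have "f \<in> opt_policies \<psi>" by (rule psi.opt_policyI)
    with f disj show False by blast
  qed
  then obtain x a where gr: "g + ?h x < bellman \<psi> a ?h x" by blast
  then have nonopt: "a \<notin> opt_actions \<phi> x" using eq[of a x] by auto
  \<comment> \<open>The kernels of \<psi> at \<open>(x, a)\<close> are transplanted into \<phi>; the
    model constrains each pair separately, so the mixture stays in it.\<close>
  define \<psi>' where "\<psi>' =
    \<lparr>trans = \<lambda>y b. if (y, b) = (x, a) then trans \<psi> y b else trans \<phi> y b,
     rew = \<lambda>y b. if (y, b) = (x, a) then rew \<psi> y b else rew \<phi> y b\<rparr>"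
  have at: "trans \<psi>' x a = trans \<psi> x a" "rew \<psi>' x a = rew \<psi> x a"
    by (simp_all add: \<psi>'_def)
  have "\<psi>' \<in> unstructured lam"
    using un in_unstructured by (simp add: unstructured_def \<psi>'_def)
  moreover have "\<phi> \<lless> \<psi>'"
    using ac by (simp add: mdp_abs_cont_def \<psi>'_def absolutely_continuous_def)
  moreover have "KL lam \<phi> \<psi>' y b = 0" if "(y, b) \<noteq> (x, a)" for y b
    using that by (intro KL_same) (auto simp: \<psi>'_def)
  moreover have "opt_gain \<phi> x + ?h x < bellman \<psi>' a ?h x"
    using gr by (simp add: g bellman_cong[OF at])
  ultimately have "\<psi>' \<in> confusing_at lam (unstructured lam) x a \<phi>" by (simp add: confusing_at_def)
  moreover have "KL lam \<phi> \<psi>' x a = KL lam \<phi> \<psi> x a" by (simp add: KL_def rew_dens_def at)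
  ultimately show ?thesis using nonopt by (intro that)
qed

end

theorem theorem2:
  fixes lam :: "real measure" and \<phi> :: "('s::finite, 'a::finite) mdp"
  assumes "sets lam = sets unit_borel"
    and "\<phi> \<in> unstructured lam"
    and "ergodic \<phi>"
  shows "feasible lam (unstructured lam) \<phi> =
    {\<eta>. (\<forall>x a. 0 \<le> \<eta> x a) \<and>
      (\<forall>x a. a \<notin> opt_actions \<phi> x \<longrightarrow>
        (\<forall>\<psi>\<in>confusing_at lam (unstructured lam) x a \<phi>. \<eta> x a * KL lam \<phi> \<psi> x a \<ge> 1))}"
proof -
  interpret unstructured_mdp lam \<phi> by unfold_locales fact+
  interpret ergodic_mdp lam \<phi>
    by unfold_locales (rule ergodic_imp_irreducible[OF assms(3)])
  have KL_ge: "0 \<le> KL lam \<phi> \<psi> x a" if "\<psi> \<in> confusing lam (unstructured lam) \<phi>" for \<psi> x a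
    using that KL_nonneg(1)[OF assms(2)] by (auto simp: confusing_def)
  show ?thesis
  proof (intro set_eqI iffI; clarsimp simp: feasible_def)
    fix \<eta> x a \<psi>
    assume \<eta>: "\<forall>\<psi>\<in>confusing lam (unstructured lam) \<phi>. 1 \<le> (\<Sum>(x, a)\<in>UNIV. \<eta> x a * KL lam \<phi> \<psi> x a)"
      and a: "a \<notin> opt_actions \<phi> x" and \<psi>: "\<psi> \<in> confusing_at lam (unstructured lam) x a \<phi>"
    have KL0: "KL lam \<phi> \<psi> y b = 0" if "(y, b) \<noteq> (x, a)" for y b
      using \<psi> that unfolding confusing_at_def by blast
    \<comment> \<open>All other summands vanish, even where \<eta> is infinite, since
      \<open>\<infinity> * 0 = 0\<close> in \<open>ereal\<close>.\<close>
    have "(\<Sum>(y, b)\<in>UNIV. \<eta> y b * KL lam \<phi> \<psi> y b) = (\<Sum>(y, b)\<in>{(x, a)}. \<eta> y b * KL lam \<phi> \<psi> y b)"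
    proof (rule sum.mono_neutral_right)
      show "\<forall>z\<in>UNIV - {(x, a)}. (case z of (y, b) \<Rightarrow> \<eta> y b * KL lam \<phi> \<psi> y b) = 0"
        using KL0 by (auto split: prod.split)
    qed simp_all
    with \<eta> confusing_at_subset_confusing[OF a \<psi>] show "1 \<le> \<eta> x a * KL lam \<phi> \<psi> x a" by fastforce
  next
    fix \<eta> \<psi>
    assume nn: "\<forall>x a. 0 \<le> \<eta> x a"
      and \<eta>: "\<forall>x a. a \<notin> opt_actions \<phi> x \<longrightarrow>
        (\<forall>\<psi>\<in>confusing_at lam (unstructured lam) x a \<phi>. 1 \<le> \<eta> x a * KL lam \<phi> \<psi> x a)"
      and \<psi>: "\<psi> \<in> confusing lam (unstructured lam) \<phi>"
    obtain x a \<psi>' where "a \<notin> opt_actions \<phi> x" "\<psi>' \<in> confusing_at lam (unstructured lam) x a \<phi>"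
      and KL: "KL lam \<phi> \<psi>' x a = KL lam \<phi> \<psi> x a"
      by (rule confusing_imp_confusing_at[OF \<psi>])
    with \<eta> have "1 \<le> \<eta> x a * KL lam \<phi> \<psi>' x a" by blast
    also have "\<dots> = (\<Sum>(x, a)\<in>{(x, a)}. \<eta> x a * KL lam \<phi> \<psi> x a)" by (simp add: KL)
    \<comment> \<open>The remaining summands are nonnegative, so the constraint at a single pair
      already bounds the whole sum.\<close>
    also have "\<dots> \<le> (\<Sum>(x, a)\<in>UNIV. \<eta> x a * KL lam \<phi> \<psi> x a)"
      by (rule sum_mono2) (use nn KL_ge[OF \<psi>] in auto)
    finally show "1 \<le> (\<Sum>(x, a)\<in>UNIV. \<eta> x a * KL lam \<phi> \<psi> x a)" .
  qed
qed

end
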